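(* Let ${\mathcal Z}$ be an integral domain with fraction field ${\mathcal Q}$ which is integrally Hilbertian. Let $\underline T=(T_1,\dots,T_k)$, $\underline Y=(Y_1,\dots,Y_n)$, and let $P_1,\dots,P_s\in{\mathcal Z}[\underline T,\underline Y]$ ($s\ge1$) be irreducible in ${\mathcal Q}[\underline T,\underline Y]$ and such that $P_1\cdots P_s$ has no nonunit divisor in ${\mathcal Z}$. For $i=1,\dots,k$ let $\underline d_i=(d_{i1},\dots,d_{in})$ be an $n$-tuple of nonnegative integers, and assume ( * ): either $\deg_{\underline Y}(P_l)\ge1$ for all $l=1,\dots,s$, or $\underline d_i\neq(0,\dots,0)$ for all $i=1,\dots,k$. (a) If $\ell(\underline d_i)>\sum_{j=1}^s\deg_{T_i}(P_j)$ for $i=1,\dots,k$, then there exist polynomials $M_1(\underline Y),\dots,M_k(\underline Y)\in{\mathcal Z}[\underline Y]$ with $M_i$ of degree $d_{ij}$ in $Y_j$ ($j=1,\dots,n$) such that the polynomials $P_l(M_1(\underline Y),\dots,M_k(\underline Y),Y_1,\dots,Y_n)$, $l=1,\dots,s$, are irreducible in ${\mathcal Z}[\underline Y]$. (b) If ${\mathcal Z}$ is a near UFD, the same conclusion holds under the condition $2^{\ell(\underline d_i)}>\sum_{j=1}^s\deg_{T_i}(P_j)$ for $i=1,\dots,k$ in place of the condition in (a). (c) If $k=1$ and $\underline d_1=(d_1,\dots,d_n)$, the same conclusion holds under the condition $\sum_{j=1}^nd_j>\sum_{i=1}^s\deg_{\underline Y}(P_i)$, and, if ${\mathcal Z}$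 is a near UFD, under the condition $\sum_{j=1}^nd_j>\max_{1\le i\le s}\deg_{\underline Y}(P_i)$.
   Context: $\ell(\underline d)=\prod_{j=1}^n(d_j+1)$ for $\underline d=(d_1,\dots,d_n)$ (the number of monic monomials of degree $\le d_j$ in $Y_j$ for all $j$). A polynomial in ${\mathcal Z}[\underline T,\underline Y]$ has a nonunit divisor in ${\mathcal Z}$ if some nonzero nonunit of ${\mathcal Z}$ divides all its coefficients. ${\mathcal Z}$ is integrally Hilbertian if for all $k,n,s\ge1$ and all $P_1,\dots,P_s\in{\mathcal Z}[\underline T,\underline Y]$ irreducible in ${\mathcal Q}[\underline T,\underline Y]$, of degree $\ge1$ in $\underline Y$, whose product has no fixed divisor w.r.t. $\underline T$ (no nonzero nonunit $a\in{\mathcal Z}$ divides all coefficients of $\prod_iP_i(\underline t,\underline Y)$ for every $\underline t\in{\mathcal Z}^k$), there is a Zariski-dense $H\subset{\mathcal Z}^k$ such that for $\underline t\in H$ each $P_i(\underline t,\underline Y)$ is irreducible in ${\mathcal Q}[\underline Y]$ and $\prod_iP_i(\underline t,\underline Y)$ has no nonunit divisor in ${\mathcal Z}$. A near UFD is an integral domain in which every nonzero element has only finitely many prime divisors up to units and every nonunit has at least one prime divisor. *)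

theory Defs
  imports
    "HOL-Library.Poly_Mapping"
    "HOL-Library.FuncSet"
    "HOL-Computational_Algebra.Polynomial_Factorial"
begin

section \<open>Polynomials in the indeterminates $T_i$ and $Y_j$\<close>

text \<open>Indices start at 0, so $T_1, \dots, T_k$ are \<open>T 0, \<dots>, T (k - 1)\<close>, and likewise for
  the $Y_j$.\<close>

datatype indet = T nat | Y nat

text \<open>Any linear order on the indeterminates will do: it makes polynomials over an integral
  domain an instance of class \<open>idom\<close>.\<close>

fun indet_code :: "indet \<Rightarrow> nat" where
  "indet_code (T i) = 2 * i"
| "indet_code (Y j) = 2 * j + 1"

lemma inj_indet_code: "inj indet_code"
proof (rule injI)
  fix x y assume "indet_code x = indet_code y"
  then show "x = y" by (cases x; cases y; simp; presburger)
qed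

instantiation indet :: linorder
begin

definition less_eq_indet :: "indet \<Rightarrow> indet \<Rightarrow> bool" where
  "x \<le> y \<longleftrightarrow> indet_code x \<le> indet_code y"

definition less_indet :: "indet \<Rightarrow> indet \<Rightarrow> bool" where
  "x < y \<longleftrightarrow> indet_code x < indet_code y"

instance
  by standard
    (auto simp: less_eq_indet_def less_indet_def dest: injD [OF inj_indet_code])

end

type_synonym 'a mpol = "(indet \<Rightarrow>\<^sub>0 nat) \<Rightarrow>\<^sub>0 'a"

definition Const :: "'a::zero \<Rightarrow> 'a mpol" where
  "Const c = Poly_Mapping.single 0 c"

definition Var :: "indet \<Rightarrow> 'a::zero_neq_one mpol" where
  "Var v = Poly_Mapping.single (Poly_Mapping.single v 1) 1"

definition Tvars :: "nat \<Rightarrow> indet set" where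
  "Tvars k = T ` {..<k}"

definition Yvars :: "nat \<Rightarrow> indet set" where
  "Yvars n = Y ` {..<n}"

definition poly_ring :: "indet set \<Rightarrow> 'a::zero mpol set" where
  "poly_ring V = {p. \<forall>m \<in> Poly_Mapping.keys p. Poly_Mapping.keys m \<subseteq> V}"

text \<open>Total degree in the indeterminates of the finite set \<open>V\<close>; the zero polynomial gets 0.
  The partial degree in a single indeterminate \<open>v\<close> is \<open>deg_in {v}\<close>.\<close>

definition deg_in :: "indet set \<Rightarrow> 'a::zero mpol \<Rightarrow> nat" where
  "deg_in V p = Max (insert 0 ((\<lambda>m. \<Sum>v\<in>V. Poly_Mapping.lookup m v) ` Poly_Mapping.keys p))"

definition eval_mpol :: "('a::zero \<Rightarrow> 'b::comm_semiring_1) \<Rightarrow> (indet \<Rightarrow> 'b) \<Rightarrow> 'a mpol \<Rightarrow> 'b" where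
  "eval_mpol c f p =
     (\<Sum>m \<in> Poly_Mapping.keys p.
        c (Poly_Mapping.lookup p m) * (\<Prod>v \<in> Poly_Mapping.keys m. f v ^ Poly_Mapping.lookup m v))"

text \<open>\<open>subst_T M p\<close> is \<open>p(M\<^sub>1, \<dots>, M\<^sub>k, Y\<^sub>1, \<dots>, Y\<^sub>n)\<close>.\<close>

definition subst_T :: "(nat \<Rightarrow> 'a mpol) \<Rightarrow> 'a::comm_ring_1 mpol \<Rightarrow> 'a mpol" where
  "subst_T M = eval_mpol Const (\<lambda>v. case v of T i \<Rightarrow> M i | Y j \<Rightarrow> Var (Y j))"

definition spec_T :: "(nat \<Rightarrow> 'a) \<Rightarrow> 'a::comm_ring_1 mpol \<Rightarrow> 'a mpol" where
  "spec_T t = subst_T (\<lambda>i. Const (t i))"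

definition to_Q :: "'a::idom mpol \<Rightarrow> 'a fract mpol" where
  "to_Q p = Poly_Mapping.map to_fract p"


section \<open>Irreducibility and divisors\<close>

text \<open>Irreducibility in a subring \<open>S\<close>: units and factors are taken in \<open>S\<close>.\<close>

definition unit_in :: "'r::comm_ring_1 set \<Rightarrow> 'r \<Rightarrow> bool" where
  "unit_in S a \<longleftrightarrow> a \<in> S \<and> (\<exists>b\<in>S. a * b = 1)"

definition irreducible_in :: "'r::comm_ring_1 set \<Rightarrow> 'r \<Rightarrow> bool" where
  "irreducible_in S p \<longleftrightarrow> p \<in> S \<and> p \<noteq> 0 \<and> \<not> unit_in S p \<and>
     (\<forall>a\<in>S. \<forall>b\<in>S. p = a * b \<longrightarrow> unit_in S a \<or> unit_in S b)"

lemma irreducible_in_UNIV: "irreducible_in UNIV p \<longleftrightarrow> irreducible p"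
  by (auto simp: irreducible_in_def irreducible_def unit_in_def dvd_def)

definition has_nonunit_divisor :: "'a::idom mpol \<Rightarrow> bool" where
  "has_nonunit_divisor p \<longleftrightarrow>
     (\<exists>a. a \<noteq> 0 \<and> \<not> a dvd 1 \<and> (\<forall>m. a dvd Poly_Mapping.lookup p m))"


section \<open>Integrally Hilbertian rings and near UFDs\<close>

definition points :: "nat \<Rightarrow> (nat \<Rightarrow> 'a) set" where
  "points k = {..<k} \<rightarrow>\<^sub>E UNIV"

text \<open>Fixed divisor with respect to \<open>T\<^sub>1, \<dots>, T\<^sub>k\<close>.\<close>

definition has_fixed_divisor :: "nat \<Rightarrow> 'a::idom mpol \<Rightarrow> bool" where
  "has_fixed_divisor k p \<longleftrightarrow>
     (\<exists>a. a \<noteq> 0 \<and> \<not> a dvd 1 \<and>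
        (\<forall>t \<in> points k. \<forall>m. a dvd Poly_Mapping.lookup (spec_T t p) m))"

text \<open>Density is in affine $k$-space over the fraction field: no nonzero polynomial in
  $T_1, \dots, T_k$ vanishes on all of \<open>H\<close>.\<close>

definition zariski_dense :: "nat \<Rightarrow> (nat \<Rightarrow> 'a::idom) set \<Rightarrow> bool" where
  "zariski_dense k H \<longleftrightarrow>
     (\<forall>f :: 'a fract mpol. f \<in> poly_ring (Tvars k) \<and> f \<noteq> 0 \<longrightarrow>
        (\<exists>t\<in>H. eval_mpol (\<lambda>c. c) (\<lambda>v. case v of T i \<Rightarrow> to_fract (t i) | Y j \<Rightarrow> 0) f \<noteq> 0))"

definition integrally_hilbertian :: "'a::idom itself \<Rightarrow> bool" where
  "integrally_hilbertian (_ :: 'a itself) \<longleftrightarrow>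
     (\<forall>k n s. \<forall>P :: nat \<Rightarrow> 'a mpol.
        k \<ge> 1 \<and> n \<ge> 1 \<and> s \<ge> 1 \<and>
        (\<forall>l<s. P l \<in> poly_ring (Tvars k \<union> Yvars n) \<and>
               irreducible_in (poly_ring (Tvars k \<union> Yvars n)) (to_Q (P l)) \<and>
               deg_in (Yvars n) (P l) \<ge> 1) \<and>
        \<not> has_fixed_divisor k (\<Prod>l<s. P l) \<longrightarrow>
        (\<exists>H \<subseteq> points k. zariski_dense k H \<and>
           (\<forall>t\<in>H. (\<forall>l<s. irreducible_in (poly_ring (Yvars n)) (to_Q (spec_T t (P l)))) \<and>
                  \<not> has_nonunit_divisor (\<Prod>l<s. spec_T t (P l)))))"

text \<open>In the second condition 0 is not counted among the nonunits, so that fields (like all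
  UFDs) are near UFDs.  For a ring that is not a field this makes no difference.\<close>

definition near_UFD :: "'a::idom itself \<Rightarrow> bool" where
  "near_UFD (_ :: 'a itself) \<longleftrightarrow>
     (\<forall>a::'a. a \<noteq> 0 \<longrightarrow>
        finite ({p. prime_elem p \<and> p dvd a} // {(p, q). \<exists>u. u dvd 1 \<and> q = u * p})) \<and>
     (\<forall>a::'a. a \<noteq> 0 \<and> \<not> a dvd 1 \<longrightarrow> (\<exists>p. prime_elem p \<and> p dvd a))"


section \<open>Polynomial values\<close>

text \<open>The number of monic monomials of degree at most \<open>d j\<close> in \<open>Y j\<close> for all \<open>j < n\<close>.\<close>

definition ell :: "nat \<Rightarrow> (nat \<Rightarrow> nat) \<Rightarrow> nat" where
  "ell n d = (\<Prod>j<n. d j + 1)"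

text \<open>The requirement \<open>M i \<noteq> 0\<close> is there because \<open>deg_in\<close> sends 0 to 0, whereas the zero
  polynomial is not of degree \<open>(0, \<dots>, 0)\<close>.\<close>

definition irreducible_values ::
    "nat \<Rightarrow> nat \<Rightarrow> nat \<Rightarrow> (nat \<Rightarrow> 'a::idom mpol) \<Rightarrow> (nat \<Rightarrow> nat \<Rightarrow> nat) \<Rightarrow> bool" where
  "irreducible_values k n s P d \<longleftrightarrow>
     (\<exists>M :: nat \<Rightarrow> 'a mpol.
        (\<forall>i<k. M i \<in> poly_ring (Yvars n) \<and> M i \<noteq> 0 \<and> (\<forall>j<n. deg_in {Y j} (M i) = d i j)) \<and>
        (\<forall>l<s. irreducible_in (poly_ring (Yvars n)) (subst_T M (P l))))"

end

theory Submission
  imports Defs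
begin

text \<open>Replace each \<open>T\<^sub>i\<close> by the generic polynomial \<open>\<Sum>\<^sub>e \<Lambda>\<^sub>i\<^sub>,\<^sub>e Y\<^sup>e\<close>, \<open>e\<close> ranging over the monomials
  of degree at most \<open>d\<^sub>i\<^sub>j\<close> in \<open>Y\<^sub>j\<close>. Up to renaming \<open>\<Lambda>\<^sub>i\<^sub>,\<^sub>0\<close> to \<open>T\<^sub>i\<close> this is an automorphism
  of the larger polynomial ring, so it preserves the irreducibility of the \<open>P\<^sub>l\<close>. The integral
  Hilbert property, applied in the indeterminates \<open>\<Lambda>\<close>, then yields the \<open>M\<^sub>i\<close>, provided no nonunit
  \<open>a\<close> divides the value of \<open>P = \<Prod>\<^sub>l P\<^sub>l\<close> at every admissible \<open>M\<close>. Under the degree conditions on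
  the \<open>T\<^sub>i\<close> such an \<open>a\<close> would divide \<open>P\<close>, because modulo \<open>a\<close> the polynomial \<open>P\<close> would vanish on a
  grid of \<open>2 ^ ell n (d i)\<close> nodes in direction \<open>i\<close> whose differences are regular modulo \<open>a\<close>; under
  the conditions of (c), one monomial of large degree as \<open>M\<^sub>1\<close> suffices, since no cancellation
  takes place. In a near UFD one may replace \<open>a\<close> by a prime divisor, which then divides the value
  of a single \<open>P\<^sub>l\<close>.\<close>

abbreviation (input) "lookup \<equiv> Poly_Mapping.lookup"
abbreviation (input) "keys \<equiv> Poly_Mapping.keys"
abbreviation (input) "single \<equiv> Poly_Mapping.single"

section \<open>Evaluation homomorphisms\<close>

text \<open>Coefficient embeddings, evaluations, substitutions and the passage to the fraction field
  are all instances, so their compatibility with sums, products and \<open>eval_mpol\<close> is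
  proved once.\<close>

locale comm_semiring_hom =
  fixes h :: "'a::comm_semiring_1 \<Rightarrow> 'b::comm_semiring_1"
  assumes zero: "h 0 = 0" and one: "h 1 = 1"
    and add: "h (x + y) = h x + h y" and mult: "h (x * y) = h x * h y"
begin

lemma sum: "h (sum f A) = (\<Sum>x\<in>A. h (f x))"
  by (induction A rule: infinite_finite_induct) (auto simp: zero add)

lemma prod: "h (prod f A) = (\<Prod>x\<in>A. h (f x))"
  by (induction A rule: infinite_finite_induct) (auto simp: one mult)

lemma power: "h (x ^ m) = h x ^ m"
  by (induction m) (auto simp: one mult)

end

lemma comm_semiring_hom_comp:
  assumes "comm_semiring_hom g" "comm_semiring_hom h"
  shows "comm_semiring_hom (\<lambda>x. g (h x))"
proof -
  interpret g: comm_semiring_hom g by fact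
  interpret h: comm_semiring_hom h by fact
  show ?thesis
    by standard (simp_all add: g.zero g.one g.add g.mult h.zero h.one h.add h.mult)
qed

lemma comm_semiring_hom_ident: "comm_semiring_hom (\<lambda>x. x)"
  by standard simp_all

definition monom_val :: "(indet \<Rightarrow> 'b::comm_semiring_1) \<Rightarrow> (indet \<Rightarrow>\<^sub>0 nat) \<Rightarrow> 'b" where
  "monom_val f m = (\<Prod>v\<in>keys m. f v ^ lookup m v)"

lemma monom_val_superset:
  assumes "finite A" "keys m \<subseteq> A"
  shows "monom_val f m = (\<Prod>v\<in>A. f v ^ lookup m v)"
  unfolding monom_val_def using assms
  by (intro prod.mono_neutral_left) (auto simp: in_keys_iff)

lemma monom_val_0 [simp]: "monom_val f 0 = 1"
  by (simp add: monom_val_def)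

lemma monom_val_add: "monom_val f (m + m') = monom_val f m * monom_val f m'"
proof -
  let ?A = "keys m \<union> keys m'"
  have "keys (m + m') \<subseteq> ?A" by (rule keys_add)
  then have "monom_val f (m + m') = (\<Prod>v\<in>?A. f v ^ lookup (m + m') v)"
    by (intro monom_val_superset) auto
  also have "\<dots> = (\<Prod>v\<in>?A. f v ^ lookup m v) * (\<Prod>v\<in>?A. f v ^ lookup m' v)"
    by (simp add: lookup_add power_add prod.distrib)
  also have "\<dots> = monom_val f m * monom_val f m'"
    by (simp add: monom_val_superset [of ?A])
  finally show ?thesis .
qed

lemma monom_val_single [simp]: "monom_val f (single v e) = f v ^ e"
  by (simp add: monom_val_def)

lemma monom_val_sum:
  "monom_val f (sum g A) = (\<Prod>x\<in>A. monom_val f (g x))"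
  by (induction A rule: infinite_finite_induct) (auto simp: monom_val_add)

lemma monom_val_cong:
  "(\<And>v. v \<in> keys m \<Longrightarrow> f v = g v) \<Longrightarrow> monom_val f m = monom_val g m"
  by (simp add: monom_val_def)

lemma (in comm_semiring_hom) monom_val: "h (monom_val f m) = monom_val (\<lambda>v. h (f v)) m"
  by (simp add: monom_val_def prod power)

lemma poly_mapping_sum_single: "p = (\<Sum>m\<in>keys p. single m (lookup p m))"
proof (rule poly_mapping_eqI)
  fix k
  show "lookup p k = lookup (\<Sum>m\<in>keys p. single m (lookup p m)) k"
    by (cases "k \<in> keys p")
      (auto simp: lookup_sum lookup_single when_def in_keys_iff)
qed

lemma eval_mpol_monom_val:
  "eval_mpol c f p = (\<Sum>m\<in>keys p. c (lookup p m) * monom_val f m)"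
  by (simp add: eval_mpol_def monom_val_def)

lemma eval_mpol_superset:
  assumes "c 0 = 0" "finite A" "keys p \<subseteq> A"
  shows "eval_mpol c f p = (\<Sum>m\<in>A. c (lookup p m) * monom_val f m)"
  unfolding eval_mpol_monom_val using assms
  by (intro sum.mono_neutral_left) (auto simp: in_keys_iff)

lemma eval_mpol_single: "c 0 = 0 \<Longrightarrow> eval_mpol c f (single m a) = c a * monom_val f m"
  by (subst eval_mpol_superset [of _ "{m}"]) auto

lemma eval_mpol_cong:
  assumes "p \<in> poly_ring V" "\<And>v. v \<in> V \<Longrightarrow> f v = g v"
  shows "eval_mpol c f p = eval_mpol c g p"
  unfolding eval_mpol_monom_val using assms
  by (intro sum.cong refl arg_cong2 [of _ _ _ _ "(*)"] monom_val_cong) (auto simp: poly_ring_def)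

context comm_semiring_hom
begin

lemma eval_mpol_Const [simp]: "eval_mpol h f (Const a) = h a"
  by (simp add: Const_def eval_mpol_single zero)

lemma eval_mpol_Var [simp]: "eval_mpol h f (Var v) = f v"
  by (simp add: Var_def eval_mpol_single zero one)

lemma eval_mpol_add: "eval_mpol h f (p + q) = eval_mpol h f p + eval_mpol h f q"
proof -
  let ?A = "keys p \<union> keys q"
  have "keys (p + q) \<subseteq> ?A" by (rule keys_add)
  then show ?thesis
    by (simp add: eval_mpol_superset [where c = h and A = ?A, OF zero] lookup_add add algebra_simps
        sum.distrib)
qed

lemma eval_mpol_sum: "eval_mpol h f (sum g A) = (\<Sum>x\<in>A. eval_mpol h f (g x))"
  by (induction A rule: infinite_finite_induct) (auto simp: eval_mpol_add, simp_all add: eval_mpol_def)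

lemma eval_mpol_mult: "eval_mpol h f (p * q) = eval_mpol h f p * eval_mpol h f q"
proof -
  have "p * q = (\<Sum>m\<in>keys p. \<Sum>m'\<in>keys q. single (m + m') (lookup p m * lookup q m'))"
    by (subst poly_mapping_sum_single [of p], subst poly_mapping_sum_single [of q])
      (simp only: sum_product mult_single)
  then have "eval_mpol h f (p * q) =
      (\<Sum>m\<in>keys p. \<Sum>m'\<in>keys q. h (lookup p m * lookup q m') * monom_val f (m + m'))"
    by (simp add: eval_mpol_sum eval_mpol_single zero)
  also have "\<dots> = eval_mpol h f p * eval_mpol h f q"
    by (simp add: eval_mpol_monom_val sum_product mult monom_val_add algebra_simps)
  finally show ?thesis .
qed

lemma eval_mpol_hom: "comm_semiring_hom (eval_mpol h f)"
proof
  show "eval_mpol h f 1 = 1"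
    using eval_mpol_single [of h f 0 1] by (simp add: zero one)
qed (auto simp: eval_mpol_add eval_mpol_mult, simp add: eval_mpol_def)

text \<open>Composing an evaluation with a homomorphism is again an evaluation; the identities
  between iterated substitutions below come from this.\<close>

lemma hom_eval_mpol: "h (eval_mpol c f p) = eval_mpol (\<lambda>x. h (c x)) (\<lambda>v. h (f v)) p"
  by (simp add: eval_mpol_monom_val sum mult monom_val)

end

section \<open>Constants and the passage to the fraction field\<close>

lemma Const_hom: "comm_semiring_hom (Const :: 'a::comm_semiring_1 \<Rightarrow> _)"
  by standard (auto simp: Const_def single_add mult_single)

interpretation Const: comm_semiring_hom "Const :: 'a::comm_semiring_1 \<Rightarrow> _"
  by (rule Const_hom)

lemma to_fract_hom: "comm_semiring_hom to_fract"
  by standard auto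

lemma monom_val_Var: "monom_val Var m = (single m 1 :: 'a::comm_semiring_1 mpol)"
proof -
  have Var_power: "Var v ^ e = (single (single v e) 1 :: 'a mpol)" for v e
  proof (induction e)
    case (Suc e)
    then show ?case by (simp add: Var_def mult_single flip: single_add)
  qed simp
  have prod_single: "(\<Prod>x\<in>A. single (g x) 1) = (single (sum g A) 1 :: 'a mpol)" for g :: "indet \<Rightarrow> _" and A
    by (induction A rule: infinite_finite_induct) (auto simp: mult_single)
  show ?thesis
    unfolding monom_val_def Var_power prod_single
    by (subst (3) poly_mapping_sum_single [of m]) simp
qed

lemma eval_mpol_Var_id [simp]: "eval_mpol Const Var p = p"
  by (subst (2) poly_mapping_sum_single [of p])
    (simp add: eval_mpol_monom_val monom_val_Var Const_def mult_single)

text \<open>Writing this coefficientwise map as an evaluation makes it a homomorphism at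
  once.\<close>

lemma to_Q_eval: "to_Q p = eval_mpol (\<lambda>a. Const (to_fract a)) Var p"
proof -
  have 0: "keys (to_Q p) \<subseteq> keys p"
    by (auto simp: to_Q_def in_keys_iff Poly_Mapping.map.rep_eq when_def)
  have 1: "lookup (to_Q p) m = to_fract (lookup p m)" for m
    by (simp add: to_Q_def Poly_Mapping.map.rep_eq when_def)
  have "to_Q p = eval_mpol Const Var (to_Q p)" by simp
  also have "\<dots> = (\<Sum>m\<in>keys p. Const (lookup (to_Q p) m) * monom_val Var m)"
    using 0 by (intro eval_mpol_superset) (auto simp: Const.zero)
  finally show ?thesis by (simp add: 1 eval_mpol_monom_val)
qed

lemma to_Q_hom: "comm_semiring_hom to_Q"
proof -
  interpret c: comm_semiring_hom "\<lambda>a. Const (to_fract a)"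
    by (rule comm_semiring_hom_comp [OF Const_hom to_fract_hom])
  show ?thesis
    unfolding to_Q_eval [abs_def] by (rule c.eval_mpol_hom)
qed

interpretation to_Q: comm_semiring_hom to_Q
  by (rule to_Q_hom)

lemma lookup_to_Q: "lookup (to_Q p) m = to_fract (lookup p m)"
  by (simp add: to_Q_def Poly_Mapping.map.rep_eq when_def)

lemma keys_to_Q [simp]: "keys (to_Q p) = keys p"
  by (auto simp: in_keys_iff lookup_to_Q)

lemma to_Q_Const [simp]: "to_Q (Const a) = Const (to_fract a)"
  by (rule poly_mapping_eqI) (auto simp: lookup_to_Q Const_def lookup_single when_def)

lemma to_Q_Var [simp]: "to_Q (Var v) = Var v"
  by (rule poly_mapping_eqI) (auto simp: lookup_to_Q Var_def lookup_single when_def)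

lemma to_Q_single [simp]: "to_Q (single m a) = single m (to_fract a)"
  by (rule poly_mapping_eqI) (auto simp: lookup_to_Q lookup_single when_def)

lemma to_Q_in_poly_ring [simp]: "to_Q p \<in> poly_ring V \<longleftrightarrow> p \<in> poly_ring V"
  by (simp add: poly_ring_def)

lemma to_Q_eq_0_iff [simp]: "to_Q p = 0 \<longleftrightarrow> p = 0"
  by (metis keys_eq_empty keys_to_Q)

lemma eval_mpol_to_Q: "eval_mpol c f (to_Q p) = eval_mpol (\<lambda>a. c (to_fract a)) f p"
  by (simp add: eval_mpol_def lookup_to_Q)

section \<open>Substitution for the indeterminates \<open>T i\<close>\<close>

definition sub_val :: "(nat \<Rightarrow> 'a mpol) \<Rightarrow> indet \<Rightarrow> 'a::comm_ring_1 mpol" where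
  "sub_val M v = (case v of T i \<Rightarrow> M i | Y j \<Rightarrow> Var (Y j))"

lemma sub_val_simps [simp]: "sub_val M (T i) = M i" "sub_val M (Y j) = Var (Y j)"
  by (simp_all add: sub_val_def)

lemma subst_T_eval: "subst_T M = eval_mpol Const (sub_val M)"
  unfolding subst_T_def sub_val_def [abs_def] by (rule refl)

interpretation subst_T: comm_semiring_hom "subst_T M"
  unfolding subst_T_eval by (rule Const.eval_mpol_hom)

lemma subst_T_Const [simp]: "subst_T M (Const a) = Const a"
  by (simp add: subst_T_eval)

lemma subst_T_Var [simp]: "subst_T M (Var v) = sub_val M v"
  by (simp add: subst_T_eval)

lemma subst_T_compose: "subst_T M (subst_T N p) = subst_T (\<lambda>i. subst_T M (N i)) p"
proof -
  have "subst_T M (subst_T N p) = eval_mpol Const (\<lambda>v. subst_T M (sub_val N v)) p"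
    unfolding subst_T_eval [of N] subst_T.hom_eval_mpol by simp
  also have "(\<lambda>v. subst_T M (sub_val N v)) = sub_val (\<lambda>i. subst_T M (N i))"
    by (auto simp: sub_val_def fun_eq_iff split: indet.splits)
  finally show ?thesis by (simp add: subst_T_eval)
qed

lemma to_Q_subst_T: "to_Q (subst_T M p) = subst_T (\<lambda>i. to_Q (M i)) (to_Q p)"
proof -
  have "to_Q (subst_T M p) = eval_mpol (\<lambda>a. Const (to_fract a)) (\<lambda>v. to_Q (sub_val M v)) p"
    unfolding subst_T_eval to_Q.hom_eval_mpol by simp
  also have "(\<lambda>v. to_Q (sub_val M v)) = sub_val (\<lambda>i. to_Q (M i))"
    by (auto simp: sub_val_def fun_eq_iff split: indet.splits)
  finally show ?thesis by (simp add: subst_T_eval eval_mpol_to_Q)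
qed

section \<open>Subrings of polynomials in given indeterminates\<close>

lemma poly_ring_mono: "V \<subseteq> W \<Longrightarrow> p \<in> poly_ring V \<Longrightarrow> p \<in> poly_ring W"
  by (auto simp: poly_ring_def)

lemma poly_ring_0 [simp]: "0 \<in> poly_ring V"
  by (simp add: poly_ring_def)

lemma poly_ring_1 [simp]: "1 \<in> poly_ring V"
  by (simp add: poly_ring_def)

lemma poly_ring_Const [simp]: "Const a \<in> poly_ring V"
  by (auto simp: poly_ring_def Const_def)

lemma poly_ring_Var [simp]: "v \<in> V \<Longrightarrow> Var v \<in> poly_ring V"
  by (auto simp: poly_ring_def Var_def)

lemma poly_ring_add [simp]: "p \<in> poly_ring V \<Longrightarrow> q \<in> poly_ring V \<Longrightarrow> p + q \<in> poly_ring V"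
  unfolding poly_ring_def using keys_add [of p q] by blast

lemma poly_ring_mult [simp]:
  assumes "p \<in> poly_ring V" "q \<in> poly_ring V" shows "p * q \<in> poly_ring V"
  unfolding poly_ring_def
proof safe
  fix m v assume "m \<in> keys (p * q)" "v \<in> keys m"
  then obtain a b where "m = a + b" "a \<in> keys p" "b \<in> keys q"
    using keys_mult [of p q] by auto
  then show "v \<in> V"
    using assms \<open>v \<in> keys m\<close> keys_add [of a b] unfolding poly_ring_def by blast
qed

lemma poly_ring_sum: "(\<And>x. x \<in> A \<Longrightarrow> f x \<in> poly_ring V) \<Longrightarrow> sum f A \<in> poly_ring V"
  by (induction A rule: infinite_finite_induct) auto

lemma poly_ring_prod: "(\<And>x. x \<in> A \<Longrightarrow> f x \<in> poly_ring V) \<Longrightarrow> prod f A \<in> poly_ring V"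
  by (induction A rule: infinite_finite_induct) auto

lemma poly_ring_power: "p \<in> poly_ring V \<Longrightarrow> p ^ e \<in> poly_ring V"
  by (induction e) auto

lemma eval_mpol_in_poly_ring:
  assumes "p \<in> poly_ring V" "\<And>v. v \<in> V \<Longrightarrow> f v \<in> poly_ring W"
  shows "eval_mpol Const f p \<in> poly_ring W"
  unfolding eval_mpol_def
  by (intro poly_ring_sum poly_ring_mult poly_ring_prod poly_ring_power poly_ring_Const assms(2))
    (use assms(1) in \<open>auto simp: poly_ring_def\<close>)

lemma subst_T_in_poly_ring:
  assumes "p \<in> poly_ring V" "\<And>v. v \<in> V \<Longrightarrow> sub_val M v \<in> poly_ring W"
  shows "subst_T M p \<in> poly_ring W"
  unfolding subst_T_eval by (rule eval_mpol_in_poly_ring [OF assms])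

lemma subst_T_ident_on:
  assumes "p \<in> poly_ring V" "\<And>i. T i \<in> V \<Longrightarrow> M i = Var (T i)"
  shows "subst_T M p = p"
proof -
  have "subst_T M p = eval_mpol Const Var p"
    unfolding subst_T_eval
    by (rule eval_mpol_cong [OF assms(1)]) (auto simp: sub_val_def assms split: indet.splits)
  then show ?thesis by simp
qed

lemma poly_ring_empty: "p \<in> poly_ring {} \<Longrightarrow> p = Const (lookup p 0)"
  by (rule poly_mapping_eqI)
    (auto simp: poly_ring_def Const_def lookup_single when_def in_keys_iff)

section \<open>Irreducibility in polynomial rings\<close>

lemma poly_ring_uminus [simp]: "- p \<in> poly_ring V \<longleftrightarrow> p \<in> poly_ring V"
  for p :: "'a::comm_ring_1 mpol"
proof -
  have "keys (- p) = keys p" by (auto simp: in_keys_iff)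
  then show ?thesis by (simp add: poly_ring_def)
qed

text \<open>Giving the indeterminates outside \<open>V\<close> weight 1, the weighted degrees of the factors add
  up to the weighted degree 0 of the product.\<close>

lemma factor_in_poly_ring:
  fixes p :: "'a::idom mpol"
  assumes "p \<in> poly_ring V" "p \<noteq> 0" "p = a * b"
  shows "a \<in> poly_ring V"
proof -
  let ?f = "\<lambda>v. if v \<in> V then [:Var v:] else [:0, Var v:] :: 'a mpol poly"
  have C: "comm_semiring_hom (\<lambda>c. [:Const c:] :: 'a mpol poly)"
    by standard (auto simp: Const.zero Const.one Const.add Const.mult)
  interpret C: comm_semiring_hom "\<lambda>c. [:Const c:] :: 'a mpol poly"
    by (rule C)
  define w where "w = eval_mpol (\<lambda>c. [:Const c:]) ?f"
  interpret w: comm_semiring_hom w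
    unfolding w_def by (rule C.eval_mpol_hom)
  have ev: "comm_semiring_hom (\<lambda>q :: 'a mpol poly. poly q x)" for x
    by standard auto
  \<comment> \<open>Evaluation at \<open>x\<close> multiplies each indeterminate outside
    \<open>V\<close> by \<open>x\<close>: at 1 it recovers \<open>q\<close>, at 0 only
    indeterminates of \<open>V\<close> survive. Once \<open>w a\<close> is constant in
    \<open>x\<close>, the two values agree.\<close>
  have w_eval: "poly (w q) x = eval_mpol Const (\<lambda>v. if v \<in> V then Var v else x * Var v) q" for q x
    unfolding w_def comm_semiring_hom.hom_eval_mpol [OF ev]
    by (simp add: if_distrib [of "\<lambda>q. poly q x"] cong: if_cong)
  have w_1: "poly (w q) 1 = q" for q
    by (simp add: w_eval cong: if_cong)
  have "degree (w p) = 0"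
  proof -
    have "w p = eval_mpol (\<lambda>c. [:Const c:]) (\<lambda>v. [:Var v:]) p"
      unfolding w_def by (rule eval_mpol_cong [OF assms(1)]) auto
    also have "\<dots> = [:p:]"
      using comm_semiring_hom.hom_eval_mpol [of "\<lambda>x. [:x:]" Const Var p]
      by (simp add: comm_semiring_hom_def)
    finally show ?thesis by simp
  qed
  moreover have "w a \<noteq> 0" "w b \<noteq> 0"
    using w_1 [of a] w_1 [of b] assms by auto
  ultimately have "degree (w a) = 0"
    using assms(3) by (simp add: w.mult degree_mult_eq)
  then obtain c where c: "w a = [:c:]"
    by (rule degree_eq_zeroE)
  then have "a = poly (w a) 0"
    using w_1 [of a] by simp
  also have "\<dots> \<in> poly_ring V"
  proof -
    have "a \<in> poly_ring UNIV" by (simp add: poly_ring_def)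
    then show ?thesis
      unfolding w_eval by (rule eval_mpol_in_poly_ring) auto
  qed
  finally show ?thesis .
qed

text \<open>A unit divides 1, which involves no indeterminate; by \<open>factor_in_poly_ring\<close>
  neither does the unit.\<close>

lemma unit_in_poly_ringD:
  fixes u :: "'a::idom mpol"
  assumes "unit_in (poly_ring V) u"
  obtains c where "u = Const c" "c \<noteq> 0"
proof -
  obtain b where "1 = u * b"
    using assms by (auto simp: unit_in_def)
  then have "u \<in> poly_ring {}"
    using factor_in_poly_ring [of 1 "{}" u b] by simp
  then have "u = Const (lookup u 0)" by (rule poly_ring_empty)
  moreover have "u \<noteq> 0" using \<open>1 = u * b\<close> by auto
  ultimately show thesis using that Const.zero by metis
qed

lemma unit_in_poly_ring_mono:
  fixes p :: "'a::idom mpol"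
  assumes "p \<in> poly_ring V" "V \<subseteq> W"
  shows "unit_in (poly_ring W) p \<longleftrightarrow> unit_in (poly_ring V) p"
proof
  assume "unit_in (poly_ring W) p"
  then obtain b where "1 = b * p"
    by (auto simp: unit_in_def mult.commute)
  moreover from this have "b \<in> poly_ring V"
    using factor_in_poly_ring [of 1 V b p] by simp
  ultimately show "unit_in (poly_ring V) p"
    using assms(1) by (auto simp: unit_in_def mult.commute intro!: bexI [of _ b])
qed (use assms poly_ring_mono in \<open>auto simp: unit_in_def\<close>)

text \<open>By \<open>factor_in_poly_ring\<close> a factorisation in the larger ring already takes
  place in the smaller one, and the units agree there.\<close>

lemma irreducible_in_poly_ring_mono:
  fixes p :: "'a::idom mpol"
  assumes "irreducible_in (poly_ring V) p" "V \<subseteq> W"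
  shows "irreducible_in (poly_ring W) p"
proof -
  have p: "p \<in> poly_ring V" "p \<noteq> 0" "\<not> unit_in (poly_ring V) p"
    using assms(1) by (auto simp: irreducible_in_def)
  have "unit_in (poly_ring W) a \<or> unit_in (poly_ring W) b" if "p = a * b" for a b
  proof -
    have "a \<in> poly_ring V" "b \<in> poly_ring V"
      using factor_in_poly_ring [OF p(1,2)] that by (metis mult.commute)+
    moreover from this have "unit_in (poly_ring V) a \<or> unit_in (poly_ring V) b"
      using assms(1) that by (auto simp: irreducible_in_def)
    ultimately show ?thesis
      using unit_in_poly_ring_mono [OF _ assms(2)] by blast
  qed
  then show ?thesis
    using p assms(2) poly_ring_mono unit_in_poly_ring_mono [OF p(1) assms(2)]
    unfolding irreducible_in_def by blast
qed

lemma irreducible_in_isomorphic: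
  assumes "comm_semiring_hom f" "comm_semiring_hom g"
    and f: "\<And>x. x \<in> S \<Longrightarrow> f x \<in> S'" and g: "\<And>y. y \<in> S' \<Longrightarrow> g y \<in> S"
    and gf: "\<And>x. x \<in> S \<Longrightarrow> g (f x) = x" and fg: "\<And>y. y \<in> S' \<Longrightarrow> f (g y) = y"
    and "irreducible_in S p"
  shows "irreducible_in S' (f p)"
proof -
  interpret f: comm_semiring_hom f by fact
  interpret g: comm_semiring_hom g by fact
  have p: "p \<in> S" "p \<noteq> 0" "\<not> unit_in S p"
    "\<And>a b. a \<in> S \<Longrightarrow> b \<in> S \<Longrightarrow> p = a * b \<Longrightarrow> unit_in S a \<or> unit_in S b"
    using assms(7) by (auto simp: irreducible_in_def)
  have unit_g: "unit_in S (g y)" if "unit_in S' y" for y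
    using that g.mult g.one g unfolding unit_in_def by metis
  have unit_f: "unit_in S' (f x)" if "unit_in S x" for x
    using that f.mult f.one f unfolding unit_in_def by metis
  show ?thesis
    unfolding irreducible_in_def
  proof (intro conjI ballI impI)
    show "f p \<in> S'" using p f by simp
    show "f p \<noteq> 0" using p gf g.zero by metis
    show "\<not> unit_in S' (f p)" using unit_g [of "f p"] p gf by auto
    fix a b assume ab: "a \<in> S'" "b \<in> S'" "f p = a * b"
    then have "p = g a * g b" using p(1) gf g.mult by metis
    then show "unit_in S' a \<or> unit_in S' b"
      using p(4) [of "g a" "g b"] ab g unit_f fg by metis
  qed
qed

text \<open>The \<open>R i\<close> only involve indeterminates of \<open>U\<close>, which the
  substitution fixes. Hence subtracting the \<open>R i\<close> undoes it, and the two substitutions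
  are mutually inverse automorphisms of \<open>poly_ring W\<close>.\<close>

lemma irreducible_in_shift:
  fixes p :: "'a::comm_ring_1 mpol"
  assumes "irreducible_in (poly_ring W) p" "U \<subseteq> W"
    and R: "\<And>i. R i \<in> poly_ring U" "\<And>i. T i \<in> U \<Longrightarrow> R i = 0"
  shows "irreducible_in (poly_ring W) (subst_T (\<lambda>i. Var (T i) + R i) p)"
proof -
  have W: "subst_T (\<lambda>i. Var (T i) + R' i) q \<in> poly_ring W"
    if "q \<in> poly_ring W" "\<And>i. R' i \<in> poly_ring U" for q R'
    by (rule subst_T_in_poly_ring [OF that(1)])
      (use poly_ring_mono [OF assms(2) that(2)] in \<open>auto simp: sub_val_def split: indet.splits\<close>)
  have inv: "subst_T (\<lambda>i. Var (T i) + R' i) (subst_T (\<lambda>i. Var (T i) - R' i) q) = q"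
    if R': "\<And>i. R' i \<in> poly_ring U" "\<And>i. T i \<in> U \<Longrightarrow> R' i = 0" for q R'
  proof -
    let ?f = "subst_T (\<lambda>i. Var (T i) + R' i)"
    have "?f (- R' i) = - R' i" for i
      by (rule subst_T_ident_on [of _ U]) (simp_all add: R')
    then have "?f (Var (T i) + (- R' i)) = Var (T i)" for i
      by (simp only: subst_T.add subst_T_Var sub_val_simps) simp
    then have "?f (subst_T (\<lambda>i. Var (T i) - R' i) q) = subst_T (\<lambda>i. Var (T i)) q"
      by (simp add: subst_T_compose)
    also have "\<dots> = q"
      by (rule subst_T_ident_on [of _ UNIV]) (simp_all add: poly_ring_def)
    finally show ?thesis .
  qed
  show ?thesis
  proof (rule irreducible_in_isomorphic [where g = "subst_T (\<lambda>i. Var (T i) + (- R i))", OF _ _ _ _ _ _ assms(1)])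
    show "subst_T (\<lambda>i. Var (T i) + - R i) (subst_T (\<lambda>i. Var (T i) + R i) x) = x" for x
      using inv [of "\<lambda>i. - R i" x] R by simp
    show "subst_T (\<lambda>i. Var (T i) + R i) (subst_T (\<lambda>i. Var (T i) + - R i) x) = x" for x
      using inv [of R x] R by simp
  qed (use W [of _ "\<lambda>i. - R i"] in \<open>auto intro!: subst_T.comm_semiring_hom_axioms W simp: R\<close>)
qed

section \<open>Divisibility by constants\<close>

lemma lookup_Const_times [simp]: "lookup (Const a * p) m = a * lookup p m"
  for a :: "'a::comm_semiring_1"
  unfolding Const_def mult_map_scale_conv_mult [symmetric]
  by (simp add: Poly_Mapping.map.rep_eq when_def)

lemma Const_dvd_iff: "Const a dvd p \<longleftrightarrow> (\<forall>m. a dvd lookup p m)"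
  for a :: "'a::comm_semiring_1"
proof
  assume *: "\<forall>m. a dvd lookup p m"
  have "Const a dvd single m (lookup p m)" for m
  proof -
    obtain b where "lookup p m = a * b" using * by (meson dvdE)
    then have "single m (lookup p m) = Const a * single m b"
      by (simp add: Const_def mult_single)
    then show ?thesis by simp
  qed
  then show "Const a dvd p"
    by (subst poly_mapping_sum_single) (intro dvd_sum)
qed (auto elim!: dvdE)

lemma has_nonunit_divisor_iff:
  "has_nonunit_divisor p \<longleftrightarrow> (\<exists>a. a \<noteq> 0 \<and> \<not> a dvd 1 \<and> Const a dvd p)"
  by (simp add: has_nonunit_divisor_def Const_dvd_iff)

lemma unit_in_Const: "a dvd 1 \<Longrightarrow> unit_in (poly_ring V) (Const a)"
  by (metis Const.mult Const.one dvdE poly_ring_Const unit_in_def)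

text \<open>A factor that becomes a unit over the fraction field is a constant dividing
  \<open>F\<close>, hence a unit by \<open>prim\<close>.\<close>

lemma irreducible_in_if_irreducible_to_Q:
  fixes F :: "'a::idom mpol"
  assumes "irreducible_in (poly_ring V) (to_Q F)"
    and prim: "\<And>a. a \<noteq> 0 \<Longrightarrow> Const a dvd F \<Longrightarrow> a dvd 1"
  shows "irreducible_in (poly_ring V) F"
  unfolding irreducible_in_def
proof (intro conjI ballI impI)
  show "F \<in> poly_ring V" "F \<noteq> 0"
    using assms(1) by (auto simp: irreducible_in_def)
  show "\<not> unit_in (poly_ring V) F"
  proof
    assume "unit_in (poly_ring V) F"
    then obtain b where "b \<in> poly_ring V" "F * b = 1" by (auto simp: unit_in_def)
    then have "to_Q b \<in> poly_ring V" "to_Q F * to_Q b = 1"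
      by (simp_all add: to_Q.one flip: to_Q.mult)
    then show False
      using assms(1) by (auto simp: irreducible_in_def unit_in_def)
  qed
  fix a b assume ab: "a \<in> poly_ring V" "b \<in> poly_ring V" "F = a * b"
  have unit: "unit_in (poly_ring V) x" if u: "unit_in (poly_ring V) (to_Q x)" "x dvd F" for x
  proof -
    obtain c where "to_Q x = Const c" using unit_in_poly_ringD [OF u(1)] by blast
    then have "to_Q x \<in> poly_ring {}" by simp
    then have "x \<in> poly_ring {}" by simp
    then have x: "x = Const (lookup x 0)" by (rule poly_ring_empty)
    have "lookup x 0 \<noteq> 0"
      using x u(2) \<open>F \<noteq> 0\<close> Const.zero by (metis dvd_0_left)
    then have "lookup x 0 dvd 1"
      using x u(2) prim by metis
    then show ?thesis using x unit_in_Const by metis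
  qed
  have "to_Q F = to_Q a * to_Q b" by (simp add: ab(3) to_Q.mult)
  then have "unit_in (poly_ring V) (to_Q a) \<or> unit_in (poly_ring V) (to_Q b)"
    using assms(1) ab(1,2) by (auto simp: irreducible_in_def)
  then show "unit_in (poly_ring V) a \<or> unit_in (poly_ring V) b"
    using unit ab(3) by (metis dvd_triv_left dvd_triv_right)
qed

section \<open>Leading coefficients modulo a constant\<close>

lemma lookup_mult_double_sum:
  fixes f g :: "'a::comm_semiring_1 mpol"
  assumes "finite A" "finite B" "keys f \<subseteq> A" "keys g \<subseteq> B"
  shows "lookup (f * g) k = (\<Sum>(x, y)\<in>A \<times> B. if x + y = k then lookup f x * lookup g y else 0)"
proof -
  have "f * g = (\<Sum>x\<in>keys f. \<Sum>y\<in>keys g. single (x + y) (lookup f x * lookup g y))"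
    by (subst poly_mapping_sum_single [of f], subst poly_mapping_sum_single [of g])
      (simp only: sum_product mult_single)
  then have "lookup (f * g) k =
      (\<Sum>(x, y)\<in>keys f \<times> keys g. if x + y = k then lookup f x * lookup g y else 0)"
    by (simp only: lookup_sum lookup_single when_def sum.cartesian_product split_def)
  also have "\<dots> = (\<Sum>(x, y)\<in>A \<times> B. if x + y = k then lookup f x * lookup g y else 0)"
    using assms by (intro sum.mono_neutral_left) (auto simp: in_keys_iff split: if_splits)
  finally show ?thesis .
qed

text \<open>The order on exponents is compatible with addition, so any pair with sum
  \<open>m + m'\<close> other than \<open>(m, m')\<close> has a component above \<open>m\<close> or
  \<open>m'\<close>, and its contribution is divisible by \<open>a\<close>.\<close>

lemma lookup_mult_leading:
  fixes f g :: "'a::comm_ring_1 mpol"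
  assumes "\<And>x. x > m \<Longrightarrow> a dvd lookup f x" "\<And>y. y > m' \<Longrightarrow> a dvd lookup g y"
  shows "a dvd lookup (f * g) (m + m') - lookup f m * lookup g m'"
proof -
  \<comment> \<open>\<open>m\<close> and \<open>m'\<close> are inserted because their coefficients
    may vanish, while the pair \<open>(m, m')\<close> must be present to be split off.\<close>
  let ?S = "insert m (keys f) \<times> insert m' (keys g)"
  let ?h = "\<lambda>(x, y). if x + y = m + m' then lookup f x * lookup g y else 0"
  have "lookup (f * g) (m + m') = sum ?h ?S"
    by (rule lookup_mult_double_sum) auto
  also have "\<dots> = ?h (m, m') + sum ?h (?S - {(m, m')})"
    by (rule sum.remove) auto
  finally have "lookup (f * g) (m + m') - lookup f m * lookup g m' = sum ?h (?S - {(m, m')})"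
    by simp
  also have "a dvd \<dots>"
  proof (rule dvd_sum)
    fix z assume "z \<in> ?S - {(m, m')}"
    then obtain x y where z: "z = (x, y)" "(x, y) \<noteq> (m, m')" by auto
    have "x > m \<or> y > m'" if "x + y = m + m'"
    proof (rule ccontr)
      assume "\<not> (x > m \<or> y > m')"
      then have le: "x \<le> m" "y \<le> m'" by auto
      then have "x + y < m + m'" if "x \<noteq> m \<or> y \<noteq> m'"
        using that add_less_le_mono [of x m y m'] add_le_less_mono [of x m y m'] by fastforce
      then show False using z \<open>x + y = m + m'\<close> by auto
    qed
    then show "a dvd ?h z" using assms z by (auto intro: dvd_mult dvd_mult2)
  qed
  finally show ?thesis .
qed

lemma obtain_leading_mod:
  fixes f :: "'a::comm_semiring_1 mpol"
  assumes "\<not> Const a dvd f"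
  obtains m where "\<not> a dvd lookup f m" "\<And>x. x > m \<Longrightarrow> a dvd lookup f x"
proof
  let ?S = "{m. \<not> a dvd lookup f m}"
  have "?S \<subseteq> keys f" by (auto simp: in_keys_iff)
  then have fin: "finite ?S" by (rule finite_subset) simp
  have "?S \<noteq> {}" using assms by (auto simp: Const_dvd_iff)
  with fin show "\<not> a dvd lookup f (Max ?S)" using Max_in by blast
  show "a dvd lookup f x" if "x > Max ?S" for x
    using that Max_ge [OF fin, of x] by (meson leD mem_Collect_eq)
qed

text \<open>A form of Gauss's lemma: otherwise \<open>p\<close> would divide the product of the
  leading coefficients of \<open>f\<close> and \<open>g\<close> modulo \<open>p\<close>.\<close>

lemma prime_elem_Const_dvd_mult:
  fixes p :: "'a::idom"
  assumes "prime_elem p" "Const p dvd f * g"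
  shows "Const p dvd f \<or> Const p dvd g"
proof (rule ccontr)
  assume "\<not> ?thesis"
  then obtain m m' where "\<not> p dvd lookup f m" "\<And>x. x > m \<Longrightarrow> p dvd lookup f x"
    and "\<not> p dvd lookup g m'" "\<And>y. y > m' \<Longrightarrow> p dvd lookup g y"
    using obtain_leading_mod by metis
  moreover have "p dvd lookup (f * g) (m + m')"
    using assms(2) by (simp add: Const_dvd_iff)
  ultimately have "p dvd lookup f m * lookup g m'"
    using lookup_mult_leading [of m p f m' g] by (metis dvd_add_right_iff diff_add_cancel)
  then show False
    using assms(1) \<open>\<not> p dvd lookup f m\<close> \<open>\<not> p dvd lookup g m'\<close>
    by (simp add: prime_elem_dvd_mult_iff)
qed

lemma prime_elem_Const_dvd_prod:
  fixes p :: "'a::idom"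
  assumes "prime_elem p" "Const p dvd prod f A"
  shows "\<exists>x\<in>A. Const p dvd f x"
  using assms(2)
proof (induction A rule: infinite_finite_induct)
  case (insert x A)
  then show ?case using prime_elem_Const_dvd_mult [OF assms(1)] by auto
qed (use assms(1) prime_elem_not_unit [of p] in
      \<open>auto simp: Const_dvd_iff lookup_one when_def split: if_splits\<close>)

text \<open>A polynomial with a unit as leading coefficient is regular modulo every constant, prime
  or not: the leading coefficient of \<open>g\<close> modulo \<open>a\<close> survives
  multiplication by a unit.\<close>

lemma Const_dvd_mult_unit_leading:
  fixes f g :: "'a::comm_ring_1 mpol"
  assumes "lookup f m dvd 1" "\<And>x. x > m \<Longrightarrow> lookup f x = 0" "Const a dvd f * g"
  shows "Const a dvd g"
proof (rule ccontr)
  assume "\<not> Const a dvd g"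
  then obtain m' where m': "\<not> a dvd lookup g m'" "\<And>y. y > m' \<Longrightarrow> a dvd lookup g y"
    by (metis obtain_leading_mod)
  have "a dvd lookup (f * g) (m + m') - lookup f m * lookup g m'"
    by (rule lookup_mult_leading) (auto simp: assms m')
  moreover have "a dvd lookup (f * g) (m + m')"
    using assms(3) by (simp add: Const_dvd_iff)
  ultimately have dvd: "a dvd lookup f m * lookup g m'"
    by (metis dvd_add_right_iff diff_add_cancel)
  obtain u where u: "lookup f m * u = 1"
    using assms(1) by (metis dvdE)
  have "a dvd (lookup f m * lookup g m') * u"
    using dvd by (rule dvd_mult2)
  also have "\<dots> = (lookup f m * u) * lookup g m'"
    by (simp only: ac_simps)
  finally have "a dvd lookup g m'"
    by (simp add: u)
  with m' show False by simp
qed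

text \<open>The polynomials with coefficients 0 and 1, which serve as nodes of the grid.\<close>

definition monom_sum :: "(indet \<Rightarrow>\<^sub>0 nat) set \<Rightarrow> 'a::comm_semiring_1 mpol" where
  "monom_sum A = (\<Sum>e\<in>A. single e 1)"

lemma lookup_monom_sum:
  "finite A \<Longrightarrow> lookup (monom_sum A) e = (if e \<in> A then 1 else 0)"
  by (simp add: monom_sum_def lookup_sum lookup_single when_def)

lemma Const_dvd_mult_monom_sum_diff:
  fixes g :: "'a::comm_ring_1 mpol"
  assumes "finite A" "finite B" "A \<noteq> B" "Const a dvd (monom_sum A - monom_sum B) * g"
  shows "Const a dvd g"
proof -
  \<comment> \<open>The exponents that do not cancel in the difference; their coefficients are 1 or
    -1.\<close>
  let ?D = "(A - B) \<union> (B - A)"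
  have D: "finite ?D" "?D \<noteq> {}" using assms by auto
  have "Max ?D \<in> ?D" using D by (rule Max_in)
  then have "lookup (monom_sum A - monom_sum B :: 'a mpol) (Max ?D) dvd 1"
    using assms by (auto simp: lookup_minus lookup_monom_sum)
  moreover have "lookup (monom_sum A - monom_sum B :: 'a mpol) x = 0" if "x > Max ?D" for x
  proof -
    have "x \<notin> ?D" using that Max_ge [OF D(1), of x] by (meson leD)
    then have "x \<in> A \<longleftrightarrow> x \<in> B" by blast
    then show ?thesis using assms by (simp add: lookup_minus lookup_monom_sum)
  qed
  ultimately show ?thesis using assms(4) by (rule Const_dvd_mult_unit_leading)
qed

lemma inj_on_monom_sum: "inj_on (monom_sum :: _ \<Rightarrow> 'a::comm_semiring_1 mpol) {A. finite A}"
proof (rule inj_onI)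
  fix A B assume AB: "A \<in> {A. finite A}" "B \<in> {A. finite A}"
    and eq: "(monom_sum A :: 'a mpol) = monom_sum B"
  have "e \<in> A \<longleftrightarrow> e \<in> B" for e
    using AB lookup_monom_sum [of A e, where 'a = 'a] lookup_monom_sum [of B e, where 'a = 'a] eq
    by (auto split: if_splits)
  then show "A = B" by blast
qed

section \<open>Degrees and boxes of monomials\<close>

lemma deg_in_ge: "m \<in> keys p \<Longrightarrow> (\<Sum>v\<in>V. lookup m v) \<le> deg_in V p"
  unfolding deg_in_def by (rule Max_ge) auto

lemma deg_in_le: "(\<And>m. m \<in> keys p \<Longrightarrow> (\<Sum>v\<in>V. lookup m v) \<le> D) \<Longrightarrow> deg_in V p \<le> D"
  unfolding deg_in_def by (rule Max.boundedI) auto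

lemma deg_in_mult_le: "deg_in V (p * q) \<le> deg_in V p + deg_in V q"
proof (rule deg_in_le)
  fix m assume "m \<in> keys (p * q)"
  then obtain a b where "m = a + b" "a \<in> keys p" "b \<in> keys q"
    using keys_mult [of p q] by auto
  then show "(\<Sum>v\<in>V. lookup m v) \<le> deg_in V p + deg_in V q"
    using deg_in_ge [of a p V] deg_in_ge [of b q V] by (simp add: lookup_add sum.distrib)
qed

lemma deg_in_prod_le: "deg_in V (prod f A) \<le> (\<Sum>x\<in>A. deg_in V (f x))"
proof (induction A rule: infinite_finite_induct)
  case (insert x A)
  then show ?case
    using deg_in_mult_le [of V "f x" "prod f A"] by simp
qed (simp_all add: deg_in_def)

lemma poly_ring_if_deg_in_eq_0:
  assumes "p \<in> poly_ring (A \<union> V)" "deg_in V p = 0" "finite V"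
  shows "p \<in> poly_ring A"
  unfolding poly_ring_def
proof safe
  fix m v assume m: "m \<in> keys p" "v \<in> keys m"
  have "(\<Sum>v\<in>V. lookup m v) = 0"
    using deg_in_ge [OF m(1), of V] assms(2) by simp
  then have "v \<notin> V" using m(2) assms(3) by (auto simp: in_keys_iff)
  then show "v \<in> A" using assms(1) m by (auto simp: poly_ring_def)
qed

lemma deg_in_eq_0:
  assumes "p \<in> poly_ring A" "A \<inter> V = {}"
  shows "deg_in V p = 0"
proof -
  have "deg_in V p \<le> 0"
  proof (rule deg_in_le)
    fix m assume "m \<in> keys p"
    then have "keys m \<inter> V = {}"
      using assms unfolding poly_ring_def by blast
    then have "lookup m v = 0" if "v \<in> V" for v
      using that by (auto simp: in_keys_iff)
    then show "(\<Sum>v\<in>V. lookup m v) \<le> 0" by simp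
  qed
  then show ?thesis by simp
qed

section \<open>Monomials in the \<open>Y j\<close> and their boxes\<close>

lemma finite_Yvars [simp]: "finite (Yvars n)"
  by (simp add: Yvars_def)

lemma Y_in_Yvars [simp]: "Y j \<in> Yvars n \<longleftrightarrow> j < n" and T_notin_Yvars [simp]: "T i \<notin> Yvars n"
  by (auto simp: Yvars_def)

lemma T_in_Tvars [simp]: "T i \<in> Tvars k \<longleftrightarrow> i < k" and Y_notin_Tvars [simp]: "Y j \<notin> Tvars k"
  by (auto simp: Tvars_def)

lemma sum_Yvars: "(\<Sum>v\<in>Yvars n. f v) = (\<Sum>j<n. f (Y j))"
  unfolding Yvars_def by (subst sum.reindex) (auto simp: inj_on_def)

lemma prod_Yvars: "(\<Prod>v\<in>Yvars n. f v) = (\<Prod>j<n. f (Y j))"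
  unfolding Yvars_def by (subst prod.reindex) (auto simp: inj_on_def)

definition ymonom :: "nat \<Rightarrow> (nat \<Rightarrow> nat) \<Rightarrow> indet \<Rightarrow>\<^sub>0 nat" where
  "ymonom n g = (\<Sum>j<n. single (Y j) (g j))"

lemma lookup_ymonom_Y [simp]: "lookup (ymonom n g) (Y j) = (if j < n then g j else 0)"
  by (simp add: ymonom_def lookup_sum lookup_single when_def)

lemma lookup_ymonom_T [simp]: "lookup (ymonom n g) (T i) = 0"
  by (simp add: ymonom_def lookup_sum lookup_single when_def)

lemma keys_ymonom: "keys (ymonom n g) \<subseteq> Yvars n"
proof
  fix v assume "v \<in> keys (ymonom n g)"
  then show "v \<in> Yvars n" by (cases v) (auto simp: in_keys_iff split: if_splits)
qed

lemma ymonom_lookup: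
  assumes "keys e \<subseteq> Yvars n"
  shows "ymonom n (\<lambda>j. lookup e (Y j)) = e"
proof (rule poly_mapping_eqI)
  fix v
  have "lookup e v = 0" if "v \<notin> Yvars n"
    using assms that by (auto simp: in_keys_iff)
  then show "lookup (ymonom n (\<lambda>j. lookup e (Y j))) v = lookup e v"
    by (cases v) auto
qed

text \<open>The exponents of the monomials counted by \<open>ell\<close>, including that of the
  constant monomial.\<close>

definition box :: "nat \<Rightarrow> (nat \<Rightarrow> nat) \<Rightarrow> (indet \<Rightarrow>\<^sub>0 nat) set" where
  "box n \<delta> = {e. keys e \<subseteq> Yvars n \<and> (\<forall>j<n. lookup e (Y j) \<le> \<delta> j)}"

lemma zero_in_box [simp]: "0 \<in> box n \<delta>"
  by (simp add: box_def)

lemma ymonom_in_box [simp]: "ymonom n \<delta> \<in> box n \<delta>"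
  by (simp add: box_def keys_ymonom)

text \<open>Identifies exponents with functions in a finite product, which yields finiteness and the
  cardinality.\<close>

lemma ymonom_image_box: "ymonom n ` (PiE {..<n} (\<lambda>j. {..\<delta> j})) = box n \<delta>"
proof (intro equalityI subsetI)
  fix e assume e: "e \<in> box n \<delta>"
  have "ymonom n (restrict (\<lambda>j. lookup e (Y j)) {..<n}) = ymonom n (\<lambda>j. lookup e (Y j))"
    by (simp add: ymonom_def)
  also have "\<dots> = e"
    using e by (intro ymonom_lookup) (simp add: box_def)
  finally show "e \<in> ymonom n ` (PiE {..<n} (\<lambda>j. {..\<delta> j}))"
    using e by (intro image_eqI [where x = "restrict (\<lambda>j. lookup e (Y j)) {..<n}"])
      (auto simp: box_def)
next
  fix e assume "e \<in> ymonom n ` (PiE {..<n} (\<lambda>j. {..\<delta> j}))"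
  then show "e \<in> box n \<delta>"
    using keys_ymonom by (auto simp: box_def PiE_iff)
qed

lemma inj_on_ymonom: "inj_on (ymonom n) (PiE {..<n} A)"
proof (rule inj_onI)
  fix g h assume gh: "g \<in> PiE {..<n} A" "h \<in> PiE {..<n} A" and eq: "ymonom n g = ymonom n h"
  show "g = h"
  proof (rule PiE_ext [OF gh])
    fix j assume "j \<in> {..<n}"
    then show "g j = h j"
      using arg_cong [OF eq, of "\<lambda>e. lookup e (Y j)"] by simp
  qed
qed

lemma finite_box [simp]: "finite (box n \<delta>)"
  unfolding ymonom_image_box [symmetric] by (simp add: finite_PiE)

lemma card_box: "card (box n \<delta>) = ell n \<delta>"
  unfolding ymonom_image_box [symmetric]
  by (simp add: card_image inj_on_ymonom card_PiE ell_def)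

section \<open>Divisibility of a polynomial by divisibility of its values\<close>

text \<open>Modulo \<open>c\<close> this is the bound on the number of zeros by the degree. It needs
  no domain, since the differences of the nodes are regular modulo \<open>c\<close>.\<close>

lemma dvd_poly_grid:
  fixes q :: "'r::comm_ring_1 poly"
  assumes "finite S" "degree q < card S"
    and "\<And>x. x \<in> S \<Longrightarrow> c dvd poly q x"
    and "\<And>x y z. x \<in> S \<Longrightarrow> y \<in> S \<Longrightarrow> x \<noteq> y \<Longrightarrow> c dvd (x - y) * z \<Longrightarrow> c dvd z"
  shows "c dvd poly q y"
  using assms
proof (induction "degree q" arbitrary: q S)
  case 0
  then obtain x where "x \<in> S" by (metis card_gt_0_iff ex_in_conv)
  moreover obtain b where "q = [:b:]" using 0 by (metis degree_eq_zeroE)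
  ultimately show ?case using 0(4) by force
next
  case (Suc m)
  then obtain x where x: "x \<in> S" by (metis card.empty ex_in_conv not_less_zero)
  \<comment> \<open>Division by the linear factor at \<open>x\<close>: for another node
    \<open>z\<close>, \<open>c\<close> divides \<open>(z - x) * poly r z\<close>, and regularity
    cancels \<open>z - x\<close>. So \<open>r\<close> satisfies the hypotheses with one node
    fewer.\<close>
  define r where "r = synthetic_div q x"
  have "[:-x, 1:] * r + [:poly q x:] = q"
    unfolding r_def by (rule synthetic_div_correct')
  then have "poly ([:-x, 1:] * r + [:poly q x:]) z = poly q z" for z by simp
  then have q: "poly q z = (z - x) * poly r z + poly q x" for z by (simp add: algebra_simps)
  have "c dvd poly r y"
  proof (rule Suc.hyps(1))
    show "m = degree r" using Suc.hyps(2) by (simp add: r_def degree_synthetic_div)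
    show "finite (S - {x})" using Suc.prems by simp
    show "degree r < card (S - {x})"
      using Suc.prems x Suc.hyps(2) by (simp add: r_def degree_synthetic_div)
    show "c dvd poly r z" if "z \<in> S - {x}" for z
    proof (rule Suc.prems(4) [of z x])
      have "c dvd (z - x) * poly r z + poly q x"
        using q [of z] Suc.prems(3) [of z] that by simp
      then show "c dvd (z - x) * poly r z"
        using Suc.prems(3) [OF x] by (simp add: dvd_add_left_iff)
    qed (use that x in auto)
  next
    fix u v w assume "u \<in> S - {x}" "v \<in> S - {x}" "u \<noteq> v" "c dvd (u - v) * w"
    then show "c dvd w" by (intro Suc.prems(4) [of u v w]) auto
  qed
  then show ?case
    unfolding q [of y] using Suc.prems(3) [OF x] by (intro dvd_add dvd_mult)
qed

lemma subst_T_cong: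
  assumes "p \<in> poly_ring (Tvars k \<union> Yvars n)" "\<And>i. i < k \<Longrightarrow> M i = N i"
  shows "subst_T M p = subst_T N p"
  unfolding subst_T_eval
  by (rule eval_mpol_cong [OF assms(1)]) (auto simp: assms(2) sub_val_def split: indet.splits)

text \<open>The nodes are replaced by the indeterminates \<open>T j\<close> one at a time, from the
  last to the first, by \<open>dvd_poly_grid\<close>.\<close>

lemma dvd_subst_T_grid:
  fixes p :: "'a::comm_ring_1 mpol" and S :: "nat \<Rightarrow> 'a mpol set"
  assumes p: "p \<in> poly_ring (Tvars k \<union> Yvars n)"
    and deg: "\<And>i. i < k \<Longrightarrow> finite (S i) \<and> deg_in {T i} p < card (S i)"
    and dvd: "\<And>M. (\<And>i. i < k \<Longrightarrow> M i \<in> S i) \<Longrightarrow> c dvd subst_T M p"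
    and reg: "\<And>i x y z. i < k \<Longrightarrow> x \<in> S i \<Longrightarrow> y \<in> S i \<Longrightarrow> x \<noteq> y \<Longrightarrow> c dvd (x - y) * z \<Longrightarrow> c dvd z"
  shows "c dvd p"
proof -
  interpret C: comm_semiring_hom "\<lambda>c. [:Const c:] :: 'a mpol poly"
    by standard (auto simp: Const.zero Const.one Const.add Const.mult)
  \<comment> \<open>Nodes are substituted for the first \<open>j\<close> indeterminates only;
    \<open>part k\<close> is the full substitution and \<open>part 0\<close> the identity.\<close>
  define part where "part j M = (\<lambda>i. if i < j then M i else Var (T i))" for j :: nat and M :: "nat \<Rightarrow> 'a mpol"
  have "\<forall>M. (\<forall>i<0. M i \<in> S i) \<longrightarrow> c dvd subst_T (part 0 M) p"
  proof (rule inc_induct [of 0 k])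
    show "\<forall>M. (\<forall>i<k. M i \<in> S i) \<longrightarrow> c dvd subst_T (part k M) p"
      by (auto intro!: dvd simp: part_def)
  next
    fix j assume j: "j < k" and IH: "\<forall>M. (\<forall>i<Suc j. M i \<in> S i) \<longrightarrow> c dvd subst_T (part (Suc j) M) p"
    show "\<forall>M. (\<forall>i<j. M i \<in> S i) \<longrightarrow> c dvd subst_T (part j M) p"
    proof (intro allI impI)
      fix M assume M: "\<forall>i<j. M i \<in> S i"
      \<comment> \<open>\<open>q\<close> is \<open>p\<close> as a univariate polynomial in
        \<open>T j\<close>, with \<open>part j M\<close> substituted for all other
        indeterminates.\<close>
      define f where "f v = (if v = T j then [:0, 1:] else [:sub_val (part j M) v:])" for v
      define q where "q = eval_mpol (\<lambda>c. [:Const c:]) f p"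
      have ev: "comm_semiring_hom (\<lambda>q :: 'a mpol poly. poly q x)" for x
        by standard auto
      have q: "poly q x = subst_T ((part j M)(j := x)) p" for x
      proof -
        have "(\<lambda>v. poly (f v) x) = sub_val ((part j M)(j := x))"
          by (auto simp: f_def fun_eq_iff sub_val_def split: indet.splits)
        then show ?thesis
          unfolding q_def comm_semiring_hom.hom_eval_mpol [OF ev] by (simp add: subst_T_eval)
      qed
      have "degree q \<le> deg_in {T j} p"
        unfolding q_def eval_mpol_monom_val
      proof (rule degree_sum_le)
        fix m assume m: "m \<in> keys p"
        have "degree (monom_val f m) \<le> (\<Sum>v\<in>keys m. degree (f v ^ lookup m v))"
          unfolding monom_val_def
          using degree_prod_sum_le [of "keys m" "\<lambda>v. f v ^ lookup m v"] by (simp add: o_def)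
        also have "\<dots> \<le> (\<Sum>v\<in>keys m. if v = T j then lookup m v else 0)"
        proof (rule sum_mono)
          fix v
          show "degree (f v ^ lookup m v) \<le> (if v = T j then lookup m v else 0)"
            using degree_power_le [of "f v" "lookup m v"] by (auto simp: f_def)
        qed
        also have "\<dots> = lookup m (T j)" by (auto simp: in_keys_iff)
        also have "\<dots> \<le> deg_in {T j} p" using deg_in_ge [OF m, of "{T j}"] by simp
        finally show "degree ([:Const (lookup p m):] * monom_val f m) \<le> deg_in {T j} p"
          using degree_mult_le [of "[:Const (lookup p m):]" "monom_val f m"] by simp
      qed auto
      then have deg_q: "degree q < card (S j)"
        using deg [OF j] by simp
      \<comment> \<open>The value of \<open>q\<close> at the indeterminate \<open>T j\<close> itself
        is the wanted one; its values at the nodes are covered by \<open>IH\<close>.\<close>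
      have "c dvd poly q (Var (T j))"
      proof (rule dvd_poly_grid [OF _ deg_q])
        fix x assume x: "x \<in> S j"
        have "(part j M)(j := x) = part (Suc j) (M(j := x))"
          by (auto simp: part_def)
        then show "c dvd poly q x"
          using IH M x by (simp add: q less_Suc_eq)
      next
        fix x y z assume "x \<in> S j" "y \<in> S j" "x \<noteq> y" "c dvd (x - y) * z"
        then show "c dvd z" by (rule reg [OF j])
      qed (use deg [OF j] in auto)
      moreover have "(part j M)(j := Var (T j)) = part j M"
        by (auto simp: part_def)
      ultimately show "c dvd subst_T (part j M) p" by (simp add: q)
    qed
  qed simp
  then have "c dvd subst_T (part 0 undefined) p" by simp
  moreover have "subst_T (part 0 undefined) p = p"
    by (rule subst_T_ident_on [OF p]) (simp add: part_def)
  ultimately show ?thesis by simp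
qed

text \<open>Differences of distinct sums of monomials have leading coefficient \<open>\<plusminus>1\<close>, hence are regular
  modulo any constant; so all \<open>2 ^ ell n (d i)\<close> sums of monomials serve as nodes, for an
  arbitrary domain.\<close>

lemma Const_dvd_if_dvd_box_values:
  fixes p :: "'a::comm_ring_1 mpol"
  assumes p: "p \<in> poly_ring (Tvars k \<union> Yvars n)"
    and deg: "\<And>i. i < k \<Longrightarrow> deg_in {T i} p < 2 ^ ell n (d i)"
    and dvd: "\<And>M. (\<And>i. i < k \<Longrightarrow> keys (M i) \<subseteq> box n (d i)) \<Longrightarrow> Const a dvd subst_T M p"
  shows "Const a dvd p"
proof (rule dvd_subst_T_grid [OF p, where S = "\<lambda>i. monom_sum ` Pow (box n (d i))"])
  have fin: "finite A" if "A \<in> Pow (box n (d i))" for A i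
    using that finite_subset [of A "box n (d i)"] by simp
  fix i assume i: "i < k"
  have "inj_on (monom_sum :: _ \<Rightarrow> 'a mpol) (Pow (box n (d i)))"
    by (rule inj_on_subset [OF inj_on_monom_sum]) (use fin in auto)
  then have "card ((monom_sum :: _ \<Rightarrow> 'a mpol) ` Pow (box n (d i))) = 2 ^ ell n (d i)"
    by (simp add: card_image card_Pow card_box)
  then show "finite ((monom_sum :: _ \<Rightarrow> 'a mpol) ` Pow (box n (d i))) \<and>
      deg_in {T i} p < card ((monom_sum :: _ \<Rightarrow> 'a mpol) ` Pow (box n (d i)))"
    using deg [OF i] by simp
  fix x y z :: "'a mpol"
  assume "x \<in> monom_sum ` Pow (box n (d i))" "y \<in> monom_sum ` Pow (box n (d i))" "x \<noteq> y"
    and dvd_z: "Const a dvd (x - y) * z"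
  then obtain A B where "A \<in> Pow (box n (d i))" "x = monom_sum A"
    and "B \<in> Pow (box n (d i))" "y = monom_sum B" by blast
  then show "Const a dvd z"
    using Const_dvd_mult_monom_sum_diff [OF fin fin, of A i B i a z] dvd_z \<open>x \<noteq> y\<close> by blast
next
  fix M :: "nat \<Rightarrow> 'a mpol"
  assume M: "\<And>i. i < k \<Longrightarrow> M i \<in> monom_sum ` Pow (box n (d i))"
  show "Const a dvd subst_T M p"
  proof (rule dvd)
    fix i assume "i < k"
    then obtain A where A: "A \<subseteq> box n (d i)" "M i = monom_sum A" using M by blast
    then have "finite A" using finite_subset by fastforce
    with A show "keys (M i) \<subseteq> box n (d i)"
      by (auto simp: in_keys_iff lookup_monom_sum split: if_splits)
  qed
qed

text \<open>If \<open>e\<close> has larger degree than \<open>p\<close> in the \<open>Y\<^sub>j\<close>, then distinct monomials of \<open>p\<close> stay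
  distinct when \<open>T 0\<close> is replaced by the monomial \<open>e\<close>.\<close>

lemma Const_dvd_if_dvd_monom_value:
  fixes p :: "'a::comm_ring_1 mpol"
  assumes p: "p \<in> poly_ring (Tvars 1 \<union> Yvars n)"
    and e: "keys e \<subseteq> Yvars n" "deg_in (Yvars n) p < (\<Sum>v\<in>Yvars n. lookup e v)"
    and M: "M 0 = single e 1" and dvd: "Const a dvd subst_T M p"
  shows "Const a dvd p"
proof -
  define w where "w m = (\<Sum>v\<in>Yvars n. lookup m v)" for m :: "indet \<Rightarrow>\<^sub>0 nat"
  \<comment> \<open>The exponent of the image of the monomial \<open>m\<close>: each factor
    \<open>T 0\<close> contributes one copy of \<open>e\<close>.\<close>
  define \<theta> where "\<theta> m = (\<Sum>i<lookup m (T 0). e) + ymonom n (\<lambda>j. lookup m (Y j))" for m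
  have w_add: "w (m + m') = w m + w m'" for m m'
    by (simp add: w_def lookup_add sum.distrib)
  have w_sum: "w (\<Sum>i<r. e) = r * w e" for r :: nat
    by (induction r) (auto simp: w_add, simp add: w_def)
  have w_\<theta>: "w (\<theta> m) = lookup m (T 0) * w e + w m" for m
  proof -
    have "w (ymonom n (\<lambda>j. lookup m (Y j))) = w m"
      by (simp add: w_def sum_Yvars)
    then show ?thesis by (simp add: \<theta>_def w_add w_sum)
  qed
  have keys_p: "keys m \<subseteq> insert (T 0) (Yvars n)" if "m \<in> keys p" for m
    using p that unfolding poly_ring_def Tvars_def by auto
  have w_less: "w m < w e" if "m \<in> keys p" for m
    using deg_in_ge [OF that, of "Yvars n"] e(2) unfolding w_def by simp
  have inj: "inj_on \<theta> (keys p)"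
  proof (rule inj_onI)
    fix m m' assume m: "m \<in> keys p" "m' \<in> keys p" and eq: "\<theta> m = \<theta> m'"
    \<comment> \<open>Since \<open>w m < w e\<close>, division with remainder by \<open>w e\<close>
      recovers the exponent of \<open>T 0\<close> from \<open>w (\<theta> m)\<close>.\<close>
    have "(lookup m (T 0) * w e + w m) div w e = (lookup m' (T 0) * w e + w m') div w e"
      using arg_cong [OF eq, of w] by (simp add: w_\<theta>)
    then have T0: "lookup m (T 0) = lookup m' (T 0)"
      using w_less [OF m(1)] w_less [OF m(2)] by simp
    then have Yeq: "ymonom n (\<lambda>j. lookup m (Y j)) = ymonom n (\<lambda>j. lookup m' (Y j))"
      using eq by (simp add: \<theta>_def)
    show "m = m'"
    proof (rule poly_mapping_eqI)
      fix v
      show "lookup m v = lookup m' v"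
      proof (cases "v \<in> insert (T 0) (Yvars n)")
        case True
        then show ?thesis
          using T0 arg_cong [OF Yeq, of "\<lambda>e. lookup e v"] by (cases v) auto
      next
        case False
        then have "v \<notin> keys m" "v \<notin> keys m'" using keys_p m by blast+
        then show ?thesis by (simp add: in_keys_iff)
      qed
    qed
  qed
  have single_power: "single e 1 ^ r = (single (\<Sum>i<r. e) 1 :: 'a mpol)" for r
    by (induction r) (auto simp: mult_single add.commute)
  have val: "monom_val (sub_val M) m = single (\<theta> m) 1" if "m \<in> keys p" for m
  proof -
    have "monom_val (sub_val M) m = (\<Prod>v\<in>insert (T 0) (Yvars n). sub_val M v ^ lookup m v)"
      using keys_p [OF that] by (intro monom_val_superset) auto
    also have "\<dots> = single e 1 ^ lookup m (T 0) * (\<Prod>j<n. Var (Y j) ^ lookup m (Y j))"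
      by (simp add: prod_Yvars M)
    also have "(\<Prod>j<n. Var (Y j) ^ lookup m (Y j)) = monom_val Var (ymonom n (\<lambda>j. lookup m (Y j)))"
      by (simp add: ymonom_def monom_val_sum)
    finally show ?thesis
      by (simp add: monom_val_Var single_power mult_single \<theta>_def)
  qed
  have eq: "subst_T M p = (\<Sum>m\<in>keys p. single (\<theta> m) (lookup p m))"
    unfolding subst_T_eval eval_mpol_monom_val
    by (intro sum.cong refl) (simp add: val Const_def mult_single)
  \<comment> \<open>By injectivity of \<open>\<theta>\<close> the coefficient of \<open>p\<close> at
    \<open>m\<close> reappears unchanged at \<open>\<theta> m\<close>.\<close>
  have "a dvd lookup p m" if m: "m \<in> keys p" for m
  proof -
    have "lookup (subst_T M p) (\<theta> m) = (\<Sum>m'\<in>keys p. if m' = m then lookup p m' else 0)"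
      unfolding eq lookup_sum
      by (intro sum.cong refl) (use inj m in \<open>auto simp: lookup_single when_def inj_on_def\<close>)
    also have "\<dots> = lookup p m" using m by simp
    finally show ?thesis using dvd by (metis Const_dvd_iff)
  qed
  then show ?thesis
    unfolding Const_dvd_iff by (metis dvd_0_right in_keys_iff)
qed

section \<open>The generic substitution\<close>

text \<open>The indeterminate \<open>T (ix i e)\<close> is the coefficient of the monomial \<open>e\<close> in the generic
  polynomial that replaces \<open>T i\<close>. As the constant coefficient is \<open>T i\<close> itself, the generic
  substitution is a shift, hence an automorphism.\<close>

locale generic_substitution =
  fixes k n N :: nat and d :: "nat \<Rightarrow> nat \<Rightarrow> nat" and ix :: "nat \<Rightarrow> (indet \<Rightarrow>\<^sub>0 nat) \<Rightarrow> nat"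
  assumes ix_0: "i < k \<Longrightarrow> ix i 0 = i"
    and ix_less: "i < k \<Longrightarrow> e \<in> box n (d i) \<Longrightarrow> ix i e < N"
    and inj_ix: "inj_on (\<lambda>(i, e). ix i e) (SIGMA i:{..<k}. box n (d i))"
begin

text \<open>It vanishes for \<open>i \<ge> k\<close>, so that \<open>gen\<close> fixes the new
  coefficient indeterminates.\<close>

definition shift :: "nat \<Rightarrow> 'a::comm_ring_1 mpol" where
  "shift i = (if i < k then \<Sum>e\<in>box n (d i) - {0}. Var (T (ix i e)) * single e 1 else 0)"

definition gen :: "nat \<Rightarrow> 'a::comm_ring_1 mpol" where
  "gen i = Var (T i) + shift i"

definition inst :: "(nat \<Rightarrow> 'a) \<Rightarrow> nat \<Rightarrow> 'a::comm_ring_1 mpol" where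
  "inst t i = (\<Sum>e\<in>box n (d i). single e (t (ix i e)))"

lemma ix_eq_iff:
  assumes "i < k" "e \<in> box n (d i)" "i' < k" "e' \<in> box n (d i')"
  shows "ix i e = ix i' e' \<longleftrightarrow> i = i' \<and> e = e'"
  using inj_onD [OF inj_ix, of "(i, e)" "(i', e')"] assms by auto

text \<open>The indices below \<open>k\<close> are already taken by the constant
  coefficients.\<close>

lemma ix_ge:
  assumes "i < k" "e \<in> box n (d i)" "e \<noteq> 0"
  shows "k \<le> ix i e"
proof (rule ccontr)
  assume *: "\<not> k \<le> ix i e"
  then have "ix (ix i e) 0 = ix i e" by (simp add: ix_0)
  then show False
    using ix_eq_iff [of "ix i e" 0 i e] * assms by simp
qed

lemma less_N: "i < k \<Longrightarrow> i < N"
  using ix_less [of i 0] by (simp add: ix_0)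

lemma gen_eq:
  "i < k \<Longrightarrow> gen i = (\<Sum>e\<in>box n (d i). Var (T (ix i e)) * single e 1)"
  by (subst sum.remove [of _ 0]) (simp_all add: gen_def shift_def ix_0)

text \<open>As \<open>ix\<close> is injective, the coefficients can be prescribed freely, with 0 at
  all other indices. The second clause keeps every \<open>u j\<close> in a given subring that
  contains the \<open>c i e\<close>.\<close>

lemma coefficients_exist:
  "\<exists>u. (\<forall>i<k. \<forall>e\<in>box n (d i). u (ix i e) = c i e) \<and> (\<forall>j. u j = 0 \<or> (\<exists>i e. u j = c i e))"
proof (intro exI conjI allI impI ballI)
  let ?S = "SIGMA i:{..<k}. box n (d i)"
  let ?u = "\<lambda>j. if j \<in> (\<lambda>(i, e). ix i e) ` ?S
    then (\<lambda>(i, e). c i e) (inv_into ?S (\<lambda>(i, e). ix i e) j) else 0"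
  show "?u (ix i e) = c i e" if "i < k" "e \<in> box n (d i)" for i e
  proof -
    have "(i, e) \<in> ?S" using that by simp
    then show ?thesis
      using inv_into_f_f [OF inj_ix, of "(i, e)"] by force
  qed
  show "?u j = 0 \<or> (\<exists>i e. ?u j = c i e)" for j
    by (auto split: prod.splits)
qed

lemma single_in_poly_ring: "e \<in> box n (d i) \<Longrightarrow> Yvars n \<subseteq> V \<Longrightarrow> single e a \<in> poly_ring V"
  by (auto simp: poly_ring_def box_def)

lemma shift_in_poly_ring: "shift i \<in> poly_ring (T ` {k..<N} \<union> Yvars n)"
  by (auto simp: shift_def ix_ge ix_less intro!: poly_ring_sum poly_ring_mult poly_ring_Var
      single_in_poly_ring [of _ i])

lemma gen_in_poly_ring: "i < k \<Longrightarrow> gen i \<in> poly_ring (Tvars N \<union> Yvars n)"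
  by (auto simp: gen_eq ix_less intro!: poly_ring_sum poly_ring_mult poly_ring_Var
      single_in_poly_ring [of _ i])

lemma subst_gen_in_poly_ring:
  assumes "p \<in> poly_ring (Tvars k \<union> Yvars n)"
  shows "subst_T gen p \<in> poly_ring (Tvars N \<union> Yvars n)"
  by (rule subst_T_in_poly_ring [OF assms])
    (auto simp: sub_val_def gen_in_poly_ring split: indet.splits)

lemma inst_in_poly_ring: "inst t i \<in> poly_ring (Yvars n)"
  unfolding inst_def by (intro poly_ring_sum single_in_poly_ring) auto

lemma lookup_inst: "lookup (inst t i) e = (if e \<in> box n (d i) then t (ix i e) else 0)"
  by (simp add: inst_def lookup_sum lookup_single when_def)

lemma to_Q_gen: "i < k \<Longrightarrow> to_Q (gen i) = gen i"
  by (simp add: gen_eq to_Q.sum to_Q.mult)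

lemma subst_T_gen:
  assumes "i < k"
  shows "subst_T u (gen i) = (\<Sum>e\<in>box n (d i). u (ix i e) * single e 1)"
proof -
  have "subst_T u (single e 1) = single e 1" if "e \<in> box n (d i)" for e
    by (rule subst_T_ident_on [OF single_in_poly_ring [OF that order.refl]]) simp
  then show ?thesis
    by (simp add: gen_eq assms subst_T.sum subst_T.mult)
qed

text \<open>Links points of \<open>N\<close>-space to choices of the polynomials \<open>M i\<close>:
  specialising the coefficients of \<open>gen i\<close> at \<open>t\<close> gives
  \<open>inst t i\<close>.\<close>

lemma spec_T_subst_gen:
  assumes "p \<in> poly_ring (Tvars k \<union> Yvars n)"
  shows "spec_T t (subst_T gen p) = subst_T (inst t) p"
proof -
  have "subst_T (\<lambda>i. Const (t i)) (gen i) = inst t i" if "i < k" for i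
    unfolding subst_T_gen [OF that] inst_def by (simp add: Const_def mult_single)
  then show ?thesis
    unfolding spec_T_def subst_T_compose by (intro subst_T_cong [OF assms])
qed

text \<open>Adjoining the new indeterminates preserves irreducibility. The generic substitution is
  then an invertible shift, as \<open>shift i\<close> only involves indeterminates that it
  fixes.\<close>

lemma irreducible_in_subst_gen:
  fixes p :: "'a::idom mpol"
  assumes "p \<in> poly_ring (Tvars k \<union> Yvars n)"
    and "irreducible_in (poly_ring (Tvars k \<union> Yvars n)) (to_Q p)"
  shows "irreducible_in (poly_ring (Tvars N \<union> Yvars n)) (to_Q (subst_T gen p))"
proof -
  have "Tvars k \<subseteq> Tvars N" using less_N by (auto simp: Tvars_def)
  then have "irreducible_in (poly_ring (Tvars N \<union> Yvars n)) (to_Q p)"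
    by (intro irreducible_in_poly_ring_mono [OF assms(2)]) auto
  then have "irreducible_in (poly_ring (Tvars N \<union> Yvars n))
      (subst_T (\<lambda>i. Var (T i) + shift i) (to_Q p))"
    by (rule irreducible_in_shift [where U = "T ` {k..<N} \<union> Yvars n"])
      (auto simp: shift_in_poly_ring, auto simp: shift_def Tvars_def)
  also have "(\<lambda>i. Var (T i) + shift i) = (gen :: nat \<Rightarrow> 'a fract mpol)"
    by (simp add: gen_def fun_eq_iff)
  also have "subst_T gen (to_Q p) = to_Q (subst_T gen p)"
    unfolding to_Q_subst_T using assms(1) by (intro subst_T_cong) (auto simp: to_Q_gen)
  finally show ?thesis .
qed

text \<open>If the generic value were free of the \<open>Y j\<close>, specialising its coefficients
  would show first that \<open>p\<close> is free of the \<open>Y j\<close> and then that it is free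
  of each \<open>T i\<close>. So \<open>p\<close> would be constant, against irreducibility.\<close>

lemma deg_in_subst_gen:
  fixes p :: "'a::idom mpol"
  assumes p: "p \<in> poly_ring (Tvars k \<union> Yvars n)"
    and irr: "irreducible_in (poly_ring (Tvars k \<union> Yvars n)) (to_Q p)"
    and d: "deg_in (Yvars n) p \<ge> 1 \<or> (\<forall>i<k. \<exists>j<n. d i j \<noteq> 0)"
  shows "deg_in (Yvars n) (subst_T gen p) \<ge> 1"
proof (rule ccontr)
  assume "\<not> ?thesis"
  then have F: "subst_T gen p \<in> poly_ring (Tvars N)"
    by (intro poly_ring_if_deg_in_eq_0 [OF subst_gen_in_poly_ring [OF p]]) auto
  have "p \<in> poly_ring (range T)"
  proof -
    \<comment> \<open>With constant coefficient \<open>T i\<close> and all other coefficients 0,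
      \<open>gen i\<close> becomes \<open>T i\<close>, which gives \<open>p\<close> back.\<close>
    obtain u where u: "\<And>i e. i < k \<Longrightarrow> e \<in> box n (d i) \<Longrightarrow>
        u (ix i e) = (if e = 0 then Var (T i) else 0 :: 'a mpol)"
      "\<And>j. u j = 0 \<or> (\<exists>i e. u j = (if e = (0 :: indet \<Rightarrow>\<^sub>0 nat) then Var (T i) else 0))"
      using coefficients_exist [of "\<lambda>i e. if e = 0 then Var (T i) else 0"] by blast
    have "u j \<in> poly_ring (range T)" for j
      using u(2) [of j] by (auto split: if_splits)
    then have "subst_T u (subst_T gen p) \<in> poly_ring (range T)"
      by (intro subst_T_in_poly_ring [OF F]) (auto simp: Tvars_def)
    moreover have "subst_T u (gen i) = Var (T i)" if "i < k" for i
    proof -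
      have "subst_T u (gen i) = (\<Sum>e\<in>box n (d i). if e = 0 then Var (T i) else 0)"
        unfolding subst_T_gen [OF that] by (intro sum.cong refl) (simp add: u(1) that)
      then show ?thesis by simp
    qed
    then have "subst_T u (subst_T gen p) = p"
      unfolding subst_T_compose by (intro subst_T_ident_on [OF p]) simp
    ultimately show ?thesis by simp
  qed
  then have deg_0: "deg_in (Yvars n) p = 0"
    by (rule deg_in_eq_0) auto
  with p have p_T: "p \<in> poly_ring (Tvars k)"
    by (rule poly_ring_if_deg_in_eq_0) simp
  have no_T: "p \<in> poly_ring (- {T i})" if i: "i < k" for i
  proof -
    obtain j where j: "j < n" "d i j \<noteq> 0" using d deg_0 i by auto
    define e0 where "e0 = ymonom n (d i)"
    have "lookup e0 (Y j) \<noteq> 0" using j by (simp add: e0_def)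
    then have "e0 \<noteq> 0" by (metis lookup_zero)
    then have e0: "e0 \<in> box n (d i)" "e0 \<noteq> 0" by (simp_all add: e0_def)
    \<comment> \<open>Here \<open>gen i\<close> becomes \<open>T i\<close> times the nonconstant
      monomial \<open>e0\<close>, while every other \<open>gen i'\<close> becomes
      \<open>T i'\<close>.\<close>
    define c :: "nat \<Rightarrow> (indet \<Rightarrow>\<^sub>0 nat) \<Rightarrow> 'a mpol" where "c = (\<lambda>i' e. if i' = i then if e = e0 then Var (T i) else 0
        else if e = 0 then Var (T i') else 0)"
    obtain u where u: "\<forall>i<k. \<forall>e\<in>box n (d i). u (ix i e) = c i e"
      using coefficients_exist [of c] by blast
    \<comment> \<open>In addition every \<open>Y j\<close> is sent to \<open>y\<close>: at 1 the
      monomial \<open>e0\<close> disappears from \<open>gen i\<close>, at 0 it kills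
      \<open>gen i\<close>.\<close>
    define E where "E y = eval_mpol Const (\<lambda>v. case v of T j \<Rightarrow> u j | Y _ \<Rightarrow> y)" for y :: "'a mpol"
    have E_hom: "comm_semiring_hom (E y)" for y
      unfolding E_def by (rule Const.eval_mpol_hom)
    have E_single: "E y (single e 1) = monom_val (\<lambda>_. y) e" if "e \<in> box n (d i')" for y e i'
      unfolding E_def
    proof (subst eval_mpol_single, simp add: Const.zero, simp add: Const.one, rule monom_val_cong)
      fix v assume "v \<in> keys e"
      then have "v \<in> Yvars n" using that by (auto simp: box_def)
      then show "(case v of T j \<Rightarrow> u j | Y _ \<Rightarrow> y) = y" by (cases v) auto
    qed
    have E_gen: "E y (gen i') = (\<Sum>e\<in>box n (d i'). c i' e * monom_val (\<lambda>_. y) e)" if "i' < k" for y i'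
    proof -
      interpret E: comm_semiring_hom "E y" by (rule E_hom)
      have "E y (Var (T (ix i' e))) = c i' e" if "e \<in> box n (d i')" for e
        using u \<open>i' < k\<close> that by (simp add: E_def)
      then show ?thesis
        unfolding gen_eq [OF that] E.sum E.mult
        by (intro sum.cong refl arg_cong2 [of _ _ _ _ "(*)"]) (auto intro: E_single)
    qed
    have monom_val_0: "monom_val (\<lambda>_. 0 :: 'a mpol) e = (if e = 0 then 1 else 0)" for e
      by (auto simp: monom_val_def in_keys_iff power_0_left)
    have monom_val_1: "monom_val (\<lambda>_. 1 :: 'a mpol) e = 1" for e
      by (simp add: monom_val_def)
    have E1_gen: "E 1 (gen i') = Var (T i')" if "i' < k" for i'
      unfolding E_gen [OF that] using e0 by (cases "i' = i") (simp_all add: monom_val_1 c_def)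
    have E0_gen: "E 0 (gen i') = (if i' = i then 0 else Var (T i'))" if "i' < k" for i'
    proof -
      have "E 0 (gen i') = (\<Sum>e\<in>box n (d i'). if e = 0 then c i' 0 else 0)"
        unfolding E_gen [OF that] by (intro sum.cong refl) (simp add: monom_val_0)
      also have "\<dots> = c i' 0" by simp
      finally show ?thesis using e0 by (simp add: c_def)
    qed
    have E_subst: "E y (subst_T gen p) = eval_mpol Const (\<lambda>v. E y (sub_val gen v)) p" for y
      unfolding subst_T_eval comm_semiring_hom.hom_eval_mpol [OF E_hom]
      by (simp add: E_def)
    \<comment> \<open>The generic value is free of the \<open>Y j\<close>, so \<open>y\<close> does
      not affect its image. Thus \<open>p\<close> equals its own value at
      \<open>T i = 0\<close>.\<close>
    have "p = eval_mpol Const Var p" by simp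
    also have "\<dots> = E 1 (subst_T gen p)"
      unfolding E_subst by (rule eval_mpol_cong [OF p_T]) (auto simp: Tvars_def E1_gen)
    also have "\<dots> = E 0 (subst_T gen p)"
      unfolding E_def by (rule eval_mpol_cong [OF F]) (auto simp: Tvars_def)
    also have "\<dots> \<in> poly_ring (- {T i})"
      unfolding E_subst by (rule eval_mpol_in_poly_ring [OF p_T]) (auto simp: Tvars_def E0_gen)
    finally show ?thesis .
  qed
  have "p \<in> poly_ring {}"
    unfolding poly_ring_def
  proof safe
    fix m v assume m: "m \<in> keys p" "v \<in> keys m"
    then have "v \<in> Tvars k" using p_T by (auto simp: poly_ring_def)
    then obtain i where "i < k" "v = T i" by (auto simp: Tvars_def)
    then show "v \<in> {}" using no_T m by (force simp: poly_ring_def)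
  qed
  then have "p = Const (lookup p 0)" by (rule poly_ring_empty)
  \<comment> \<open>Over the fraction field a constant is 0 or a unit, hence not
    irreducible.\<close>
  then obtain a where a: "to_Q p = Const a" by (metis to_Q_Const)
  moreover from this have "a \<noteq> 0" using irr Const.zero by (auto simp: irreducible_in_def)
  ultimately show False
    using irr unit_in_Const [of a] by (auto simp: irreducible_in_def dvd_field_iff)
qed

section \<open>Choosing the coefficients by the integral Hilbert property\<close>

lemma zariski_dense_obtain:
  fixes H :: "(nat \<Rightarrow> 'a::idom) set"
  assumes "zariski_dense N H"
  obtains t where "t \<in> H" "\<forall>i<k. t (ix i (ymonom n (d i))) \<noteq> 0"
proof -
  \<comment> \<open>The product of the top coefficients of the generic polynomials. Where it does
    not vanish, the degrees are exactly the \<open>d i j\<close>.\<close>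
  define f :: "'a fract mpol" where "f = (\<Prod>i<k. Var (T (ix i (ymonom n (d i)))))"
  have "f \<in> poly_ring (Tvars N)"
    unfolding f_def by (intro poly_ring_prod poly_ring_Var) (simp add: ix_less)
  moreover have "f \<noteq> 0"
  proof -
    have "Var v \<noteq> (0 :: 'a fract mpol)" for v
    proof
      assume "Var v = (0 :: 'a fract mpol)"
      from arg_cong [OF this, of "\<lambda>p. lookup p (single v 1)"] show False
        by (simp add: Var_def)
    qed
    then show ?thesis by (simp add: f_def)
  qed
  ultimately obtain t where t: "t \<in> H" and nz:
    "eval_mpol (\<lambda>c. c) (\<lambda>v. case v of T i \<Rightarrow> to_fract (t i) | Y j \<Rightarrow> 0) f \<noteq> 0"
    using assms unfolding zariski_dense_def by blast
  interpret ev: comm_semiring_hom "eval_mpol (\<lambda>c :: 'a fract. c) g" for g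
    by (rule comm_semiring_hom.eval_mpol_hom [OF comm_semiring_hom_ident])
  have "t (ix i (ymonom n (d i))) \<noteq> 0" if "i < k" for i
    using nz that unfolding f_def ev.prod
    by (simp add: comm_semiring_hom.eval_mpol_Var [OF comm_semiring_hom_ident])
  with t that show thesis by blast
qed

text \<open>Reduces all cases to \<open>nofix\<close>: for each nonunit \<open>a\<close>, it
  suffices to exhibit one choice of \<open>M\<close>, with degrees merely bounded by the
  \<open>d i j\<close>, at which \<open>a\<close> does not divide the value of the product.\<close>

lemma irreducible_valuesI:
  fixes P :: "nat \<Rightarrow> 'a::idom mpol"
  assumes hilb: "integrally_hilbertian TYPE('a)"
    and k: "k \<ge> 1" and n: "n \<ge> 1" and s: "s \<ge> 1"
    and P: "\<forall>l<s. P l \<in> poly_ring (Tvars k \<union> Yvars n)"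
    and irr: "\<forall>l<s. irreducible_in (poly_ring (Tvars k \<union> Yvars n)) (to_Q (P l))"
    and d: "(\<forall>l<s. deg_in (Yvars n) (P l) \<ge> 1) \<or> (\<forall>i<k. \<exists>j<n. d i j \<noteq> 0)"
    and nofix: "\<And>a. a \<noteq> 0 \<Longrightarrow> \<not> a dvd 1 \<Longrightarrow>
      \<exists>M. (\<forall>i<k. keys (M i) \<subseteq> box n (d i)) \<and> \<not> Const a dvd subst_T M (\<Prod>l<s. P l)"
  shows "irreducible_values k n s P d"
proof -
  define F where "F l = subst_T gen (P l)" for l
  have prod_P: "(\<Prod>l<s. P l) \<in> poly_ring (Tvars k \<union> Yvars n)"
    using P by (intro poly_ring_prod) auto
  have spec_F: "spec_T t (F l) = subst_T (inst t) (P l)" if "l < s" for t l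
    unfolding F_def using P that by (intro spec_T_subst_gen) auto
  have "\<not> has_fixed_divisor N (\<Prod>l<s. F l)"
    unfolding has_fixed_divisor_def
  proof (intro notI, elim exE conjE)
    fix a :: 'a
    assume a: "a \<noteq> 0" "\<not> a dvd 1"
      and *: "\<forall>t\<in>points N. \<forall>m. a dvd lookup (spec_T t (\<Prod>l<s. F l)) m"
    obtain M where M: "\<forall>i<k. keys (M i) \<subseteq> box n (d i)"
      and ndvd: "\<not> Const a dvd subst_T M (\<Prod>l<s. P l)"
      using nofix a by blast
    obtain u where u: "\<forall>i<k. \<forall>e\<in>box n (d i). u (ix i e) = lookup (M i) e"
      using coefficients_exist [of "\<lambda>i e. lookup (M i) e"] by blast
    \<comment> \<open>The coefficient vector of \<open>M\<close> as a point of
      \<open>N\<close>-space; \<open>restrict\<close> is required by the extensionality in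
      \<open>points\<close>, and all \<open>ix i e\<close> lie below \<open>N\<close>.\<close>
    define t where "t = restrict u {..<N}"
    have "inst t i = M i" if "i < k" for i
    proof (rule poly_mapping_eqI)
      fix e
      have "e \<notin> keys (M i)" if "e \<notin> box n (d i)"
        using M \<open>i < k\<close> that by blast
      then have "lookup (M i) e = 0" if "e \<notin> box n (d i)"
        using that by (simp add: in_keys_iff)
      then show "lookup (inst t i) e = lookup (M i) e"
        using that by (simp add: lookup_inst t_def u ix_less)
    qed
    then have "subst_T (inst t) (\<Prod>l<s. P l) = subst_T M (\<Prod>l<s. P l)"
      by (intro subst_T_cong [OF prod_P])
    moreover have "spec_T t (\<Prod>l<s. F l) = subst_T (inst t) (\<Prod>l<s. P l)"
      unfolding F_def subst_T.prod [symmetric] by (rule spec_T_subst_gen [OF prod_P])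
    ultimately have "spec_T t (\<Prod>l<s. F l) = subst_T M (\<Prod>l<s. P l)" by simp
    moreover have "t \<in> points N" by (simp add: t_def points_def)
    then have "Const a dvd spec_T t (\<Prod>l<s. F l)"
      using * unfolding Const_dvd_iff by blast
    ultimately show False
      using ndvd by simp
  qed
  moreover have "\<forall>l<s. F l \<in> poly_ring (Tvars N \<union> Yvars n) \<and>
      irreducible_in (poly_ring (Tvars N \<union> Yvars n)) (to_Q (F l)) \<and> deg_in (Yvars n) (F l) \<ge> 1"
    unfolding F_def
    using P irr d by (intro allI impI conjI subst_gen_in_poly_ring irreducible_in_subst_gen deg_in_subst_gen) auto
  moreover have "N \<ge> 1" using less_N [of 0] k by simp
  ultimately have "\<exists>H\<subseteq>points N. zariski_dense N H \<and>
      (\<forall>t\<in>H. (\<forall>l<s. irreducible_in (poly_ring (Yvars n)) (to_Q (spec_T t (F l)))) \<and>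
        \<not> has_nonunit_divisor (\<Prod>l<s. spec_T t (F l)))"
    using n s
    by (intro hilb [unfolded integrally_hilbertian_def, THEN spec, of N, THEN spec, of n,
          THEN spec, of s, THEN spec, of F, THEN mp] conjI)
  then obtain H where dense: "zariski_dense N H"
    and H: "\<And>t. t \<in> H \<Longrightarrow> (\<forall>l<s. irreducible_in (poly_ring (Yvars n)) (to_Q (spec_T t (F l)))) \<and>
      \<not> has_nonunit_divisor (\<Prod>l<s. spec_T t (F l))"
    by meson
  from dense obtain t where t: "t \<in> H" "\<forall>i<k. t (ix i (ymonom n (d i))) \<noteq> 0"
    by (rule zariski_dense_obtain)
  show ?thesis
    unfolding irreducible_values_def
  proof (intro exI [of _ "inst t"] conjI allI impI)
    fix i assume i: "i < k"
    have top: "ymonom n (d i) \<in> keys (inst t i)"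
      using t(2) i by (simp add: in_keys_iff lookup_inst)
    show "inst t i \<in> poly_ring (Yvars n)" by (rule inst_in_poly_ring)
    show "inst t i \<noteq> 0" using top by auto
    fix j assume j: "j < n"
    have "deg_in {Y j} (inst t i) \<le> d i j"
      by (rule deg_in_le) (use j in \<open>auto simp: in_keys_iff lookup_inst box_def split: if_splits\<close>)
    moreover have "d i j \<le> deg_in {Y j} (inst t i)"
      using deg_in_ge [OF top, of "{Y j}"] j by simp
    ultimately show "deg_in {Y j} (inst t i) = d i j" by simp
  next
    fix l assume l: "l < s"
    have "irreducible_in (poly_ring (Yvars n)) (spec_T t (F l))"
    proof (rule irreducible_in_if_irreducible_to_Q)
      show "irreducible_in (poly_ring (Yvars n)) (to_Q (spec_T t (F l)))"
        using H t(1) l by blast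
      fix a :: 'a assume a: "a \<noteq> 0" "Const a dvd spec_T t (F l)"
      \<comment> \<open>A constant dividing one factor divides the product, which has no nonunit
        divisor.\<close>
      have "spec_T t (F l) dvd (\<Prod>l<s. spec_T t (F l))"
        using l by (intro dvd_prodI) auto
      then show "a dvd 1"
        using H [OF t(1)] a dvd_trans unfolding has_nonunit_divisor_iff by blast
    qed
    then show "irreducible_in (poly_ring (Yvars n)) (subst_T (inst t) (P l))"
      by (simp add: spec_F l)
  qed
qed

end

section \<open>Numbering the coefficients, and the cases of the theorem\<close>

lemma generic_substitution_exists: "\<exists>N ix. generic_substitution k n N d ix"
proof -
  \<comment> \<open>The nonconstant coefficients, finite in number, receive the indices from
    \<open>k\<close> on.\<close>
  define A where "A = (SIGMA i:{..<k}. box n (d i) - {0})"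
  have "finite A" by (simp add: A_def)
  then obtain g where g: "bij_betw g A {0..<card A}"
    using ex_bij_betw_finite_nat by blast
  have "generic_substitution k n (k + card A) d (\<lambda>i e. if e = 0 then i else k + g (i, e))"
  proof
    fix i e assume "i < k" "e \<in> box n (d i)"
    then show "(if e = 0 then i else k + g (i, e)) < k + card A"
      using bij_betw_apply [OF g, of "(i, e)"] by (auto simp: A_def)
  next
    show "inj_on (\<lambda>(i, e). if e = 0 then i else k + g (i, e)) (SIGMA i:{..<k}. box n (d i))"
    proof (rule inj_onI, clarsimp split: if_splits)
      fix i e i' e'
      assume "i < k" "e \<in> box n (d i)" "i' < k" "e' \<in> box n (d i')"
        "g (i, e) = g (i', e')" "e \<noteq> 0" "e' \<noteq> 0"
      then show "i = i' \<and> e = e'"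
        using inj_onD [OF bij_betw_imp_inj_on [OF g], of "(i, e)" "(i', e')"] by (simp add: A_def)
    qed
  qed auto
  then show ?thesis by blast
qed

theorem theorem4p1:
  fixes P :: "nat \<Rightarrow> 'a::idom mpol" and d :: "nat \<Rightarrow> nat \<Rightarrow> nat" and k n s :: nat
  assumes "integrally_hilbertian TYPE('a)"
    and "k \<ge> 1" and "n \<ge> 1" and "s \<ge> 1"
    and "\<forall>l<s. P l \<in> poly_ring (Tvars k \<union> Yvars n)"
    and "\<forall>l<s. irreducible_in (poly_ring (Tvars k \<union> Yvars n)) (to_Q (P l))"
    and "\<not> has_nonunit_divisor (\<Prod>l<s. P l)"
    and "(\<forall>l<s. deg_in (Yvars n) (P l) \<ge> 1) \<or> (\<forall>i<k. \<exists>j<n. d i j \<noteq> 0)"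
  shows
    "((\<forall>i<k. ell n (d i) > (\<Sum>l<s. deg_in {T i} (P l))) \<longrightarrow> irreducible_values k n s P d) \<and>
     (near_UFD TYPE('a) \<and> (\<forall>i<k. 2 ^ ell n (d i) > (\<Sum>l<s. deg_in {T i} (P l))) \<longrightarrow>
        irreducible_values k n s P d) \<and>
     (k = 1 \<and> (\<Sum>j<n. d 0 j) > (\<Sum>l<s. deg_in (Yvars n) (P l)) \<longrightarrow>
        irreducible_values k n s P d) \<and>
     (k = 1 \<and> near_UFD TYPE('a) \<and>
        (\<Sum>j<n. d 0 j) > Max ((\<lambda>l. deg_in (Yvars n) (P l)) ` {..<s}) \<longrightarrow>
        irreducible_values k n s P d)"
proof -
  obtain N ix where "generic_substitution k n N d ix"
    using generic_substitution_exists by blast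
  then interpret generic_substitution k n N d ix .
  note valuesI = irreducible_valuesI [OF assms(1-6,8)]
  have prod_P: "(\<Prod>l<s. P l) \<in> poly_ring (Tvars k \<union> Yvars n)"
    using assms(5) by (intro poly_ring_prod) auto
  have prim: "\<not> Const a dvd (\<Prod>l<s. P l)" if "a \<noteq> 0" "\<not> a dvd 1" for a
    using assms(7) that by (auto simp: has_nonunit_divisor_iff)
  \<comment> \<open>Serves both (a) and (b): an \<open>a\<close> dividing all admissible values
    would divide the product of the \<open>P l\<close>, against \<open>prim\<close>.\<close>
  have b: "irreducible_values k n s P d"
    if deg: "\<And>i. i < k \<Longrightarrow> (\<Sum>l<s. deg_in {T i} (P l)) < 2 ^ ell n (d i)"
  proof (rule valuesI, rule ccontr)
    fix a :: 'a
    assume a: "a \<noteq> 0" "\<not> a dvd 1"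
      and *: "\<nexists>M. (\<forall>i<k. keys (M i) \<subseteq> box n (d i)) \<and> \<not> Const a dvd subst_T M (\<Prod>l<s. P l)"
    have "Const a dvd (\<Prod>l<s. P l)"
    proof (rule Const_dvd_if_dvd_box_values [OF prod_P])
      show "deg_in {T i} (\<Prod>l<s. P l) < 2 ^ ell n (d i)" if "i < k" for i
        using deg_in_prod_le [of "{T i}" P "{..<s}"] deg [OF that] by (rule le_less_trans)
    qed (use * in blast)
    with prim a show False by blast
  qed
  \<comment> \<open>The single monomial of top degree; for \<open>k = 1\<close> its total degree is
    the sum of the \<open>d 0 j\<close>.\<close>
  define M :: "nat \<Rightarrow> 'a mpol" where "M i = single (ymonom n (d i)) 1" for i
  have M: "\<forall>i<k. keys (M i) \<subseteq> box n (d i)"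
    by (simp add: M_def)
  have M_dvd: "Const a dvd p"
    if "k = 1" "p \<in> poly_ring (Tvars k \<union> Yvars n)" "deg_in (Yvars n) p < (\<Sum>j<n. d 0 j)"
      "Const a dvd subst_T M p" for a p
    by (rule Const_dvd_if_dvd_monom_value [of p n "ymonom n (d 0)" M])
      (use that in \<open>auto simp: keys_ymonom sum_Yvars M_def\<close>)
  have c: "irreducible_values k n s P d"
    if c_assms: "k = 1" "(\<Sum>l<s. deg_in (Yvars n) (P l)) < (\<Sum>j<n. d 0 j)"
  proof (rule valuesI, intro exI [of _ M] conjI M notI)
    fix a :: 'a
    assume a: "a \<noteq> 0" "\<not> a dvd 1" "Const a dvd subst_T M (\<Prod>l<s. P l)"
    have "deg_in (Yvars n) (\<Prod>l<s. P l) < (\<Sum>j<n. d 0 j)"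
      using deg_in_prod_le c_assms(2) by (rule le_less_trans)
    then show False using M_dvd [OF c_assms(1) prod_P _ a(3)] prim a by blast
  qed
  have c': "irreducible_values k n s P d"
    if c_assms: "k = 1" "near_UFD TYPE('a)" "Max ((\<lambda>l. deg_in (Yvars n) (P l)) ` {..<s}) < (\<Sum>j<n. d 0 j)"
  proof (rule valuesI, intro exI [of _ M] conjI M notI)
    fix a :: 'a
    assume a: "a \<noteq> 0" "\<not> a dvd 1" "Const a dvd subst_T M (\<Prod>l<s. P l)"
    \<comment> \<open>For a prime \<open>p\<close> it is enough to control the one factor
      \<open>P l\<close> whose value it divides, hence the maximum of the degrees in place of their
      sum.\<close>
    then obtain p where p: "prime_elem p" "p dvd a"
      using c_assms(2) unfolding near_UFD_def by blast
    then have "Const p dvd Const a" by (auto simp: Const.mult elim!: dvdE)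
    then have "Const p dvd (\<Prod>l<s. subst_T M (P l))"
      using a(3) dvd_trans by (simp add: subst_T.prod)
    then obtain l where l: "l < s" "Const p dvd subst_T M (P l)"
      using prime_elem_Const_dvd_prod [OF p(1)] by blast
    have "deg_in (Yvars n) (P l) \<le> Max ((\<lambda>l. deg_in (Yvars n) (P l)) ` {..<s})"
      using l(1) by (intro Max_ge) auto
    then have "deg_in (Yvars n) (P l) < (\<Sum>j<n. d 0 j)"
      using c_assms(3) by (rule le_less_trans)
    then have "Const p dvd P l"
      using M_dvd [OF c_assms(1) _ _ l(2)] assms(5) l(1) by simp
    moreover have "P l dvd (\<Prod>l<s. P l)" using l(1) by (intro dvd_prodI) auto
    ultimately have "Const p dvd (\<Prod>l<s. P l)" by (rule dvd_trans)
    then show False using prim p(1) by (auto simp: prime_elem_def)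
  qed
  \<comment> \<open>Case (a) follows from \<open>b\<close>, since a natural number is less than 2 to
    its power.\<close>
  have "irreducible_values k n s P d"
    if "\<forall>i<k. ell n (d i) > (\<Sum>l<s. deg_in {T i} (P l))"
    using that by (intro b) (meson less_exp less_trans)
  with b c c' show ?thesis by blast
qed

end
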